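(* For a compact space $K$, the following conditions are equivalent: (i) $K$ is $\omega$-Corson; (ii) $K$ has a closure preserving cover consisting of finite dimensional metrizable compacta; (iii) $K$ is hereditarily metacompact and each nonempty subspace $A$ of $K$ contains a nonempty relatively open, finite dimensional subspace $U$ of countable weight.
   Context: All topological spaces are assumed to be completely regular Hausdorff (Tikhonov). A compact space $K$ is $\omega$-Corson if for some set $\Gamma$ it is homeomorphic to a subset of $\{x\in\mathbb{R}^\Gamma:\ |\{\gamma\in\Gamma: x(\gamma)\neq 0\}|<\omega\}$ (with the product topology). A family $\mathcal{A}$ of subsets of a space $X$ is closure preserving if $\overline{\bigcup\mathcal{A}'}=\bigcup\{\overline{A}:A\in\mathcal{A}'\}$ for every subfamily $\mathcal{A}'\subseteq\mathcal{A}$. A space is metacompact if every open cover has a point-finite open refinement (covering the space), and hereditarily metacompact if every subspace is metacompact. Dimension means covering dimension $\dim$. The weight of a space is the minimal cardinality of a base. *)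

theory Defs
  imports "HOL-Analysis.Analysis"
begin

definition finite_support_space :: "'g set \<Rightarrow> ('g \<Rightarrow> real) topology"
  where "finite_support_space \<Gamma> =
    subtopology (powertop_real \<Gamma>) {x \<in> topspace (powertop_real \<Gamma>). finite {\<gamma> \<in> \<Gamma>. x \<gamma> \<noteq> 0}}"

(* HOL cannot quantify over the type of the index set. Index sets contained in the type
   'a \<Rightarrow> real lose no generality: an embedding with an arbitrary index set can be re-indexed
   by the set of its coordinate functions, see omega_corsonI below. *)
definition omega_corson :: "'a topology \<Rightarrow> bool"
  where "omega_corson K \<longleftrightarrow>
    (\<exists>(\<Gamma> :: ('a \<Rightarrow> real) set) S. S \<subseteq> topspace (finite_support_space \<Gamma>) \<and>
       K homeomorphic_space subtopology (finite_support_space \<Gamma>) S)"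

lemma omega_corsonI:
  fixes K :: "'a topology" and \<Gamma> :: "'g set"
  assumes S: "S \<subseteq> topspace (finite_support_space \<Gamma>)"
    and hom: "K homeomorphic_space subtopology (finite_support_space \<Gamma>) S"
  shows "omega_corson K"
proof -
  obtain h k where hk: "homeomorphic_maps K (subtopology (finite_support_space \<Gamma>) S) h k"
    using hom unfolding homeomorphic_space_def by blast
  define f where "f \<gamma> = (\<lambda>a. h a \<gamma>)" for \<gamma>
  define G where "G = f ` \<Gamma>"
  define g where "g a = (\<lambda>\<phi>\<in>G. \<phi> a)" for a
  define r where "r y = (\<lambda>\<gamma>\<in>\<Gamma>. y (f \<gamma>))" for y :: "('a \<Rightarrow> real) \<Rightarrow> real"
  define T where "T = g ` topspace K"
  have ch: "continuous_map K (subtopology (finite_support_space \<Gamma>) S) h"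
    and ck: "continuous_map (subtopology (finite_support_space \<Gamma>) S) K k"
    and kh: "\<And>a. a \<in> topspace K \<Longrightarrow> k (h a) = a"
    using hk by (auto simp: homeomorphic_maps_def)
  have hS: "h a \<in> S" "h a \<in> topspace (powertop_real \<Gamma>)" "finite {\<gamma> \<in> \<Gamma>. h a \<gamma> \<noteq> 0}"
    if "a \<in> topspace K" for a
    using continuous_map_image_subset_topspace[OF ch] that
    by (auto simp: finite_support_space_def)
  have rg: "r (g a) = h a" if "a \<in> topspace K" for a
    using hS(2)[OF that]
    by (auto simp: r_def g_def G_def f_def PiE_def extensional_def fun_eq_iff)
  have "continuous_map K (powertop_real \<Gamma>) h"
    using ch by (simp add: finite_support_space_def continuous_map_in_subtopology)
  then have cf: "continuous_map K euclideanreal \<phi>" if "\<phi> \<in> G" for \<phi>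
    using that by (auto simp: G_def f_def continuous_map_componentwise)
  have T_sub: "T \<subseteq> topspace (finite_support_space G)"
  proof
    fix y assume "y \<in> T"
    then obtain a where a: "a \<in> topspace K" "y = g a" by (auto simp: T_def)
    have "{\<phi> \<in> G. y \<phi> \<noteq> 0} \<subseteq> f ` {\<gamma> \<in> \<Gamma>. h a \<gamma> \<noteq> 0}"
      using a by (auto simp: g_def G_def f_def)
    then have "finite {\<phi> \<in> G. y \<phi> \<noteq> 0}"
      using hS(3)[OF a(1)] finite_surj by blast
    then show "y \<in> topspace (finite_support_space G)"
      using a by (auto simp: finite_support_space_def g_def)
  qed
  have cg: "continuous_map K (powertop_real G) g"
    unfolding continuous_map_componentwise using cf by (auto simp: g_def)
  then have cg': "continuous_map K (subtopology (finite_support_space G) T) g"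
    using T_sub by (auto simp: finite_support_space_def continuous_map_in_subtopology T_def)
  have "continuous_map (powertop_real G) (powertop_real \<Gamma>) r"
    unfolding continuous_map_componentwise
    by (auto simp: r_def G_def intro: continuous_map_product_projection)
  then have "continuous_map (subtopology (finite_support_space G) T) (powertop_real \<Gamma>) r"
    unfolding finite_support_space_def by (intro continuous_map_from_subtopology)
  moreover have "r y \<in> S" "finite {\<gamma> \<in> \<Gamma>. r y \<gamma> \<noteq> 0}" "r y \<in> topspace (powertop_real \<Gamma>)"
    if y: "y \<in> T" for y
  proof -
    obtain a where "a \<in> topspace K" "y = g a" using y by (auto simp: T_def)
    then show "r y \<in> S" "finite {\<gamma> \<in> \<Gamma>. r y \<gamma> \<noteq> 0}" "r y \<in> topspace (powertop_real \<Gamma>)"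
      using rg hS by simp_all
  qed
  ultimately have "continuous_map (subtopology (finite_support_space G) T)
                     (subtopology (finite_support_space \<Gamma>) S) r"
    by (auto simp: finite_support_space_def continuous_map_in_subtopology)
  then have "continuous_map (subtopology (finite_support_space G) T) K (k \<circ> r)"
    using ck continuous_map_compose by blast
  then have "homeomorphic_maps K (subtopology (finite_support_space G) T) g (k \<circ> r)"
    using cg' rg kh by (auto simp: homeomorphic_maps_def T_def)
  then show ?thesis
    unfolding omega_corson_def homeomorphic_space_def using T_sub by blast
qed

definition closure_preserving_in :: "'a topology \<Rightarrow> 'a set set \<Rightarrow> bool"
  where "closure_preserving_in X \<A> \<longleftrightarrow>
    (\<forall>A\<in>\<A>. A \<subseteq> topspace X) \<and>
    (\<forall>\<B>\<subseteq>\<A>. X closure_of (\<Union>\<B>) = (\<Union>A\<in>\<B>. X closure_of A))"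

definition open_cover_of :: "'a topology \<Rightarrow> 'a set set \<Rightarrow> bool"
  where "open_cover_of X \<U> \<longleftrightarrow> (\<forall>U\<in>\<U>. openin X U) \<and> \<Union>\<U> = topspace X"

definition refines :: "'a set set \<Rightarrow> 'a set set \<Rightarrow> bool"
  where "refines \<V> \<U> \<longleftrightarrow> (\<forall>V\<in>\<V>. \<exists>U\<in>\<U>. V \<subseteq> U)"

definition metacompact_space :: "'a topology \<Rightarrow> bool"
  where "metacompact_space X \<longleftrightarrow>
    (\<forall>\<U>. open_cover_of X \<U> \<longrightarrow>
      (\<exists>\<V>. open_cover_of X \<V> \<and> refines \<V> \<U> \<and> (\<forall>x\<in>topspace X. finite {V \<in> \<V>. x \<in> V})))"

definition hereditarily_metacompact_space :: "'a topology \<Rightarrow> bool"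
  where "hereditarily_metacompact_space X \<longleftrightarrow>
    (\<forall>A\<subseteq>topspace X. metacompact_space (subtopology X A))"

(* dim X <= n: order at most n means that every point lies in at most n + 1 members, and
   n = -1 holds exactly for the empty space. For general Tikhonov spaces one uses functionally
   open covers instead; in metrizable spaces every open set is functionally open, so the two
   definitions coincide there. *)
definition covering_dim_le :: "'a topology \<Rightarrow> int \<Rightarrow> bool"
  where "covering_dim_le X n \<longleftrightarrow>
    -1 \<le> n \<and>
    (\<forall>\<U>. finite \<U> \<and> open_cover_of X \<U> \<longrightarrow>
      (\<exists>\<V>. finite \<V> \<and> open_cover_of X \<V> \<and> refines \<V> \<U> \<and>
        (\<forall>x\<in>topspace X. int (card {V \<in> \<V>. x \<in> V}) \<le> n + 1)))"

definition finite_dimensional_space :: "'a topology \<Rightarrow> bool"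
  where "finite_dimensional_space X \<longleftrightarrow> (\<exists>n. covering_dim_le X n)"

end

theory Submission
  imports Defs
begin

text \<open>The implications run in a circle. A compact space is \<open>\<omega>\<close>-Corson iff it carries a point-finite
  family of continuous real functions that separates points; the sets of points whose support lies in
  a given finite set of these functions form the closure preserving cover of (ii).

  For (ii) \<open>\<Longrightarrow>\<close> (iii), a chain argument by induction on cardinality covers every open set by a
  point-finite family of cozero sets. A cozero set of \<open>f\<close> splits into the shells
  \<open>1/(n+2) < f < 1/n\<close>, whose closures are compact subsets of the open set, so every open cover of it
  has a point-finite refinement.

  For (iii) \<open>\<Longrightarrow>\<close> (i), call an open set good if a family of continuous functions on the whole space
  is point-finite on it and separates its points. Metacompactness makes unions of good sets good: multiply
  the families by functions supported in the members of a point-finite cover. The largest good set is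
  everything, since otherwise a finite dimensional metrizable piece of its complement could be added,
  using a weak form of the Menger-Noebeling theorem (finitely many functions separate the points).\<close>

section \<open>Coordinates and covering dimension\<close>

text \<open>Finite dimension has to be proved for arbitrary subspaces, but covering dimension passes
  directly only to closed ones. So the dimension of a space is never compared with that of a general
  subspace: finitely many separating functions are extracted from a finite dimensional compactum,
  restricted, and finite dimension is recovered from their number. The bounds obtained are crude,
  but only finiteness matters.

  The obstacle in (ii) \<Longrightarrow> (iii) is that members of a closure preserving cover may
  accumulate anywhere, so functions chosen for them independently need not be point-finite. This
  forces the transfinite construction, and with it a statement that quantifies over a closed set to
  be avoided. Functions are used instead of open sets because their superlevel sets are closed, so
  compactness applies to finite intersections of them. Closure preservation makes the union of every
  stage closed, which yields both the next set to avoid and the compactness used at limit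
  stages.\<close>

lemma openin_finite_Ball:
  assumes "finite I" "\<And>i. i \<in> I \<Longrightarrow> openin X {y \<in> topspace X. P i y}"
  shows "openin X {y \<in> topspace X. \<forall>i\<in>I. P i y}"
  using assms
proof (induction I rule: finite_induct)
  case (insert i I)
  have "{y \<in> topspace X. \<forall>j\<in>insert i I. P j y}
      = {y \<in> topspace X. P i y} \<inter> {y \<in> topspace X. \<forall>j\<in>I. P j y}" by auto
  with insert show ?case by (simp add: openin_Int)
qed auto

lemma openin_real_less:
  assumes "continuous_map X euclideanreal f" "continuous_map X euclideanreal g"
  shows "openin X {x \<in> topspace X. f x < g x}"
proof -
  have "continuous_map X euclideanreal (\<lambda>x. g x - f x)"
    using assms by (intro continuous_intros)
  then have "openin X {x \<in> topspace X. (\<lambda>x. g x - f x) x \<in> {0<..}}"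
    by (rule openin_continuous_map_preimage) auto
  then show ?thesis by simp
qed

lemma closedin_real_le:
  assumes "continuous_map X euclideanreal f" "continuous_map X euclideanreal g"
  shows "closedin X {x \<in> topspace X. f x \<le> g x}"
proof -
  have "continuous_map X euclideanreal (\<lambda>x. g x - f x)"
    using assms by (intro continuous_intros)
  then have "closedin X {x \<in> topspace X. (\<lambda>x. g x - f x) x \<in> {0..}}"
    by (rule closedin_continuous_map_preimage) auto
  then show ?thesis by simp
qed

lemma continuous_map_realI:
  assumes "\<And>x e::real. x \<in> topspace X \<Longrightarrow> 0 < e \<Longrightarrow>
      \<exists>U. openin X U \<and> x \<in> U \<and> (\<forall>y\<in>U. \<bar>f y - f x\<bar> < e)"
  shows "continuous_map X euclideanreal f"
  using assms Met_TC.continuous_map_to_metric[of X f] by (simp add: dist_real_def abs_minus_commute)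

lemma openin_coordinate_box:
  fixes c :: "'i \<Rightarrow> 'a \<Rightarrow> real"
  assumes "finite I" "\<And>i. i \<in> I \<Longrightarrow> continuous_map X euclideanreal (c i)"
  shows "openin X {y \<in> topspace X. \<forall>i\<in>I. \<bar>c i y - t i\<bar> < e i}"
  by (rule openin_finite_Ball[OF assms(1)], rule openin_real_less)
     (use assms(2) in \<open>auto intro!: continuous_intros\<close>)

text \<open>Shell \<open>k\<close> reaches from half of \<open>(1/2)^k\<close> to twice
  \<open>(1/2)^k\<close>. Neighbouring shells overlap, so open shells can cover, but shells two or
  more steps apart are disjoint.\<close>

lemma card_dyadic_shells:
  fixes r :: real
  shows "finite {k::nat. (1/2)^(k+1) < r \<and> r < 2 * (1/2)^k}"
    and "card {k::nat. (1/2)^(k+1) < r \<and> r < 2 * (1/2)^k} \<le> 2"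
proof -
  define S where "S = {k::nat. (1/2)^(k+1) < r \<and> r < 2 * (1/2)^k}"
  define k0 where "k0 = (LEAST k. k \<in> S)"
  have sub: "S \<subseteq> {k0, Suc k0}"
  proof
    fix l assume l: "l \<in> S"
    have k0: "k0 \<in> S" unfolding k0_def using l by (rule LeastI)
    have le: "k0 \<le> l" unfolding k0_def using l by (rule Least_le)
    show "l \<in> {k0, Suc k0}"
    proof (rule ccontr)
      assume "l \<notin> {k0, Suc k0}"
      with le have "k0 + 2 \<le> l" by auto
      then have "(1/2::real)^l \<le> (1/2)^(k0+2)" by (intro power_decreasing) auto
      with k0 l show False by (auto simp: S_def)
    qed
  qed
  have "finite S" using sub finite_subset by blast
  moreover have "card S \<le> card {k0, Suc k0}" by (rule card_mono[OF _ sub]) simp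
  ultimately show "finite {k::nat. (1/2)^(k+1) < r \<and> r < 2 * (1/2)^k}"
    and "card {k::nat. (1/2)^(k+1) < r \<and> r < 2 * (1/2)^k} \<le> 2"
    by (simp_all add: S_def)
qed

text \<open>A Whitney decomposition: dyadic shells of the Lebesgue number of the cover are crossed with
  grids of the corresponding mesh, so that the number of pieces meeting at a point is bounded by
  the number of coordinates alone, without any compactness.\<close>
lemma finite_dimensional_space_coordinates:
  fixes c :: "'i \<Rightarrow> 'a \<Rightarrow> real"
  assumes I: "finite I" and c: "\<And>i. i \<in> I \<Longrightarrow> continuous_map X euclideanreal (c i)"
    and nb: "\<And>U x. openin X U \<Longrightarrow> x \<in> U \<Longrightarrow>
          \<exists>e>0. \<forall>y\<in>topspace X. (\<forall>i\<in>I. \<bar>c i y - c i x\<bar> < e) \<longrightarrow> y \<in> U"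
  shows "finite_dimensional_space X"
proof -
  \<comment> \<open>A point lies in at most two dyadic shells and, within each, in at most two grid
    intervals per coordinate.\<close>
  define M where "M = (2 * 2 ^ card I :: nat)"
  have "\<exists>\<V>. finite \<V> \<and> open_cover_of X \<V> \<and> refines \<V> \<U> \<and>
        (\<forall>x\<in>topspace X. card {V \<in> \<V>. x \<in> V} \<le> M)"
    if fin: "finite \<U>" and cov: "open_cover_of X \<U>" for \<U>
  proof -
    define B where "B x t U \<longleftrightarrow> (\<forall>y\<in>topspace X. (\<forall>i\<in>I. \<bar>c i y - c i x\<bar> < t) \<longrightarrow> y \<in> U)" for x t U
    \<comment> \<open>The cap 1 keeps the supremum finite when a member contains balls of every
      radius, and it lets the shells start at \<open>k = 0\<close>.\<close>
    define T where "T x = {t. 0 < t \<and> t \<le> 1 \<and> (\<exists>U\<in>\<U>. B x t U)}" for x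
    define r where "r x = Sup (T x)" for x
    have U: "openin X U" if "U \<in> \<U>" for U using cov that by (auto simp: open_cover_of_def)
    have Tne: "T x \<noteq> {}" if x: "x \<in> topspace X" for x
    proof -
      obtain U where "U \<in> \<U>" "x \<in> U" using cov x by (auto simp: open_cover_of_def)
      with nb U obtain e where e: "e > 0" "B x e U" unfolding B_def by meson
      then have "B x (min e 1) U" by (auto simp: B_def)
      with e \<open>U \<in> \<U>\<close> have "min e 1 \<in> T x" by (auto simp: T_def)
      then show ?thesis by auto
    qed
    have bdd: "bdd_above (T x)" for x by (auto simp: T_def intro!: bdd_aboveI[of _ 1])
    have r_pos: "0 < r x" and r_le: "r x \<le> 1" if x: "x \<in> topspace X" for x
    proof -
      obtain t where "t \<in> T x" using Tne[OF x] by auto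
      then show "0 < r x" using cSup_upper[OF _ bdd, of t x] by (auto simp: r_def T_def)
      show "r x \<le> 1" unfolding r_def using Tne[OF x] by (intro cSup_least) (auto simp: T_def)
    qed
    have ball: "\<exists>U\<in>\<U>. B x s U" if x: "x \<in> topspace X" and s: "s < r x" for x s
    proof -
      obtain t where "t \<in> T x" "s < t"
        using less_cSupD[OF Tne[OF x]] s unfolding r_def by blast
      then show ?thesis by (auto simp: T_def B_def) (meson less_trans)
    qed
    \<comment> \<open>The radius is 1-Lipschitz for the maximum distance of the coordinates: the
      ball of radius \<open>s\<close> about \<open>x\<close> contains the ball of radius
      \<open>s - d\<close> about \<open>y\<close>.\<close>
    have lip: "r x - d \<le> r y"
      if xy: "x \<in> topspace X" "y \<in> topspace X" and d: "\<And>i. i \<in> I \<Longrightarrow> \<bar>c i y - c i x\<bar> \<le> d" "0 \<le> d" for x y d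
    proof (rule ccontr)
      assume "\<not> r x - d \<le> r y"
      then obtain s where s: "r y + d < s" "s < r x" using dense[of "r y + d" "r x"] by auto
      from ball[OF xy(1) s(2)] obtain V where V: "V \<in> \<U>" "B x s V" by auto
      have "B y (s - d) V"
        unfolding B_def
      proof (intro ballI impI)
        fix z assume z: "z \<in> topspace X" "\<forall>i\<in>I. \<bar>c i z - c i y\<bar> < s - d"
        have "\<bar>c i z - c i x\<bar> < s" if "i \<in> I" for i
        proof -
          have "\<bar>c i z - c i y\<bar> < s - d" "\<bar>c i y - c i x\<bar> \<le> d" using z(2) d(1) that by auto
          then show ?thesis by linarith
        qed
        then show "z \<in> V" using V(2) z(1) by (auto simp: B_def)
      qed
      moreover have "0 < s - d" using s r_pos[OF xy(2)] by auto
      moreover have "s - d \<le> 1" using s d r_le[OF xy(1)] by auto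
      ultimately have "s - d \<in> T y" using V by (auto simp: T_def)
      then have "s - d \<le> r y" unfolding r_def using bdd by (rule cSup_upper)
      then show False using s by auto
    qed
    have r_cont: "continuous_map X euclideanreal r"
    proof (rule continuous_map_realI)
      fix x and e :: real assume x: "x \<in> topspace X" and e: "0 < e"
      let ?W = "{y \<in> topspace X. \<forall>i\<in>I. \<bar>c i y - c i x\<bar> < e/2}"
      have "openin X ?W" using I c by (rule openin_coordinate_box)
      moreover have "x \<in> ?W" using x e by auto
      moreover have "\<bar>r y - r x\<bar> < e" if y: "y \<in> ?W" for y
      proof -
        have "r x - e/2 \<le> r y" using y e x by (intro lip) auto
        moreover have "r y - e/2 \<le> r x" using y e x by (intro lip) (auto simp: abs_minus_commute less_imp_le)
        ultimately show ?thesis using e by linarith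
      qed
      ultimately show "\<exists>U. openin X U \<and> x \<in> U \<and> (\<forall>y\<in>U. \<bar>r y - r x\<bar> < e)" by blast
    qed
    define h where "h k = (1/2::real)^k" for k :: nat
    \<comment> \<open>Two points of one cube differ by less than
      \<open>2 * h (k+2) = h (k+1)\<close> in each coordinate. Since \<open>h (k+1) < r x\<close> on
      the shell, a whole piece lies in such a ball about any of its points, hence in one member of
      \<open>\<U>\<close>.\<close>
    define Q where "Q = (\<lambda>(k, m). {x \<in> topspace X. h (k+1) < r x \<and> r x < 2 * h k \<and>
       (\<forall>i\<in>I. \<bar>c i x - of_int (m i) * h (k+2)\<bar> < h (k+2))})"
    define P where "P = (UNIV :: nat set) \<times> (I \<rightarrow>\<^sub>E (UNIV :: int set))"
    have Q_open: "openin X (Q p)" for p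
    proof (cases p)
      case (Pair k m)
      have "Q p = {x \<in> topspace X. h (k+1) < r x} \<inter> {x \<in> topspace X. r x < 2 * h k} \<inter>
         {x \<in> topspace X. \<forall>i\<in>I. \<bar>c i x - of_int (m i) * h (k+2)\<bar> < h (k+2)}"
        by (auto simp: Q_def Pair)
      then show ?thesis
        using r_cont I c by (auto intro!: openin_Int openin_real_less openin_coordinate_box)
    qed
    have Q_sub: "\<exists>U\<in>\<U>. Q p \<subseteq> U" if ne: "Q p \<noteq> {}" for p
    proof -
      obtain k m where p: "p = (k, m)" by (cases p)
      obtain x where x: "x \<in> Q p" using ne by auto
      then have "\<exists>U\<in>\<U>. B x (h (k+1)) U" by (intro ball) (auto simp: Q_def p)
      then obtain U where U: "U \<in> \<U>" "B x (h (k+1)) U" by auto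
      have "Q p \<subseteq> U"
      proof
        fix y assume y: "y \<in> Q p"
        have "\<bar>c i y - c i x\<bar> < h (k+1)" if "i \<in> I" for i
        proof -
          have "\<bar>c i x - of_int (m i) * h (k+2)\<bar> < h (k+2)" "\<bar>c i y - of_int (m i) * h (k+2)\<bar> < h (k+2)"
            using x y that by (auto simp: Q_def p)
          moreover have "h (k+1) = h (k+2) + h (k+2)" by (simp add: h_def)
          ultimately show ?thesis by linarith
        qed
        then show "y \<in> U" using U(2) y by (auto simp: B_def Q_def p)
      qed
      with U show ?thesis by auto
    qed
    then obtain u where u: "\<And>p. Q p \<noteq> {} \<Longrightarrow> u p \<in> \<U> \<and> Q p \<subseteq> u p" by metis
    \<comment> \<open>There may be infinitely many pieces. Collecting those assigned to the same
      \<open>U\<close> gives a finite refinement, and the order does not grow: every member through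
      \<open>x\<close> comes from a piece through \<open>x\<close>.\<close>
    define V where "V U = \<Union>(Q ` {p \<in> P. Q p \<noteq> {} \<and> u p = U})" for U
    have Q_card: "finite {p \<in> P. x \<in> Q p} \<and> card {p \<in> P. x \<in> Q p} \<le> M" if x: "x \<in> topspace X" for x
    proof -
      let ?K = "{k::nat. (1/2)^(k+1) < r x \<and> r x < 2 * (1/2)^k}"
      define F where "F k = (PiE I (\<lambda>i. {\<lfloor>c i x / h (k+2)\<rfloor>, \<lfloor>c i x / h (k+2)\<rfloor> + 1}))" for k
      have sub: "{p \<in> P. x \<in> Q p} \<subseteq> Sigma ?K F"
      proof
        fix p assume p: "p \<in> {p \<in> P. x \<in> Q p}"
        obtain k m where pkm: "p = (k, m)" by (cases p)
        with p have km: "(k, m) \<in> P" "x \<in> Q (k, m)" by auto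
        have "m i \<in> {\<lfloor>c i x / h (k+2)\<rfloor>, \<lfloor>c i x / h (k+2)\<rfloor> + 1}" if "i \<in> I" for i
        proof -
          have hp: "h (k+2) > 0" by (simp add: h_def)
          have "\<bar>c i x - of_int (m i) * h (k+2)\<bar> < h (k+2)" using km that by (auto simp: Q_def)
          then have "c i x < (of_int (m i) + 1) * h (k+2)" "(of_int (m i) - 1) * h (k+2) < c i x"
            by (auto simp: algebra_simps abs_less_iff)
          then have "c i x / h (k+2) < of_int (m i) + 1" "of_int (m i) - 1 < c i x / h (k+2)"
            using hp by (auto simp: field_simps)
          then show ?thesis by simp linarith
        qed
        then show "p \<in> Sigma ?K F" using km unfolding pkm by (auto simp: P_def Q_def h_def F_def PiE_iff)
      qed
      have F: "finite (F k)" "card (F k) = 2 ^ card I" for k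
        using I by (auto simp: F_def card_PiE finite_PiE numeral_2_eq_2[symmetric])
      have fS: "finite (Sigma ?K F)" using card_dyadic_shells(1) F by (intro finite_SigmaI) auto
      have "card (Sigma ?K F) = (\<Sum>k\<in>?K. card (F k))" using card_dyadic_shells(1) F by (intro card_SigmaI) auto
      also have "\<dots> = card ?K * 2 ^ card I" using F by simp
      also have "\<dots> \<le> M" using card_dyadic_shells(2)[of "r x"] by (auto simp: M_def)
      finally show ?thesis using sub fS by (meson card_mono finite_subset order_trans)
    qed
    show ?thesis
    proof (intro exI[of _ "V ` \<U>"] conjI ballI)
      have "\<exists>p\<in>P. x \<in> Q p" if x: "x \<in> topspace X" for x
      proof -
        define k where "k = (LEAST k. h (k+1) < r x)"
        obtain n where "h n < r x" using real_arch_pow_inv[OF r_pos[OF x], of "1/2"] by (auto simp: h_def)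
        then have "h (n+1) < r x" using r_pos[OF x] by (simp add: h_def)
        then have k1: "h (k+1) < r x" unfolding k_def by (rule LeastI)
        have k2: "r x < 2 * h k"
        proof (cases k)
          case 0 then show ?thesis using r_le[OF x] by (simp add: h_def)
        next
          case (Suc j)
          then have "\<not> h (j+1) < r x" using not_less_Least[of j "\<lambda>k. h (k+1) < r x"] by (auto simp: k_def)
          moreover have "h (j + 1) > 0" by (simp add: h_def)
          ultimately show ?thesis using Suc by simp
        qed
        define m where "m = (\<lambda>i\<in>I. \<lfloor>c i x / h (k+2)\<rfloor>)"
        have hp: "h (k+2) > 0" by (simp add: h_def)
        have "\<bar>c i x - of_int (m i) * h (k+2)\<bar> < h (k+2)" if "i \<in> I" for i
        proof -
          have "of_int (m i) \<le> c i x / h (k+2)" "c i x / h (k+2) < of_int (m i) + 1"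
            using that by (auto simp: m_def)
          then have "of_int (m i) * h (k+2) \<le> c i x" "c i x < (of_int (m i) + 1) * h (k+2)"
            using hp by (auto simp: field_simps)
          then show ?thesis using hp by (auto simp: algebra_simps)
        qed
        then have "x \<in> Q (k, m)" using k1 k2 x by (auto simp: Q_def)
        moreover have "(k, m) \<in> P" by (auto simp: P_def m_def)
        ultimately show ?thesis by blast
      qed
      moreover have "x \<in> V (u p)" "u p \<in> \<U>" if "p \<in> P" "x \<in> Q p" for x p
        using that u[of p] unfolding V_def by blast+
      ultimately have "topspace X \<subseteq> \<Union>(V ` \<U>)" by blast
      moreover have "openin X (V U)" for U unfolding V_def using Q_open by (intro openin_Union) auto
      ultimately show "open_cover_of X (V ` \<U>)"
        unfolding open_cover_of_def using openin_subset by blast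
      show "refines (V ` \<U>) \<U>" unfolding refines_def V_def using u by blast
      fix x assume x: "x \<in> topspace X"
      have "{W \<in> V ` \<U>. x \<in> W} \<subseteq> (\<lambda>p. V (u p)) ` {p \<in> P. x \<in> Q p}"
      proof
        fix W assume "W \<in> {W \<in> V ` \<U>. x \<in> W}"
        then obtain U where U: "W = V U" "x \<in> V U" by auto
        then obtain p where "p \<in> P" "x \<in> Q p" "u p = U" unfolding V_def by blast
        with U show "W \<in> (\<lambda>p. V (u p)) ` {p \<in> P. x \<in> Q p}" by blast
      qed
      then have "card {W \<in> V ` \<U>. x \<in> W} \<le> card {p \<in> P. x \<in> Q p}"
        using Q_card[OF x] by (meson card_image_le card_mono finite_imageI order_trans)
      then show "card {W \<in> V ` \<U>. x \<in> W} \<le> M" using Q_card[OF x] by linarith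
    qed (use fin in auto)
  qed
  then have "covering_dim_le X (int M - 1)" unfolding covering_dim_le_def by simp
  then show ?thesis unfolding finite_dimensional_space_def by blast
qed

section \<open>Point-finite separating families\<close>

text \<open>Continuity is required on all of \<open>K\<close>, the other two conditions only on
  \<open>S\<close>; this lets \<open>S\<close> grow while the functions are kept. A set of functions
  is its own index set, which is the form that \<open>omega_corson\<close> expects.\<close>

definition separating_family :: "'a topology \<Rightarrow> 'a set \<Rightarrow> ('a \<Rightarrow> real) set \<Rightarrow> bool" where
  "separating_family K S F \<longleftrightarrow>
     (\<forall>f\<in>F. continuous_map K euclideanreal f) \<and>
     (\<forall>x\<in>S. finite {f \<in> F. f x \<noteq> 0}) \<and>
     (\<forall>x\<in>S. \<forall>y\<in>S. x \<noteq> y \<longrightarrow> (\<exists>f\<in>F. f x \<noteq> f y))"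

lemma homeomorphic_powertop_real:
  fixes c :: "'i \<Rightarrow> 'a \<Rightarrow> real"
  assumes K: "compact_space K" and c: "\<And>i. i \<in> I \<Longrightarrow> continuous_map K euclideanreal (c i)"
    and inj: "\<And>x y. \<lbrakk>x \<in> topspace K; y \<in> topspace K; \<forall>i\<in>I. c i x = c i y\<rbrakk> \<Longrightarrow> x = y"
  shows "K homeomorphic_space
     subtopology (powertop_real I) ((\<lambda>x. \<lambda>i\<in>I. c i x) ` topspace K)"
proof -
  let ?g = "\<lambda>x. \<lambda>i\<in>I. c i x"
  let ?Y = "subtopology (powertop_real I) (?g ` topspace K)"
  have "continuous_map K (powertop_real I) ?g"
    unfolding continuous_map_componentwise using c by auto
  then have cont: "continuous_map K ?Y ?g" by (simp add: continuous_map_in_subtopology)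
  have top: "?g ` topspace K = topspace ?Y" by auto
  have "Hausdorff_space ?Y"
    by (intro Hausdorff_space_subtopology) (simp add: Hausdorff_space_product_topology)
  moreover have "inj_on ?g (topspace K)"
  proof (rule inj_onI)
    fix x y assume xy: "x \<in> topspace K" "y \<in> topspace K" "?g x = ?g y"
    have "\<forall>i\<in>I. c i x = c i y" using fun_cong[OF xy(3)] by (metis restrict_apply')
    then show "x = y" using inj xy by blast
  qed
  ultimately have "homeomorphic_map K ?Y ?g"
    using cont K top by (intro continuous_imp_homeomorphic_map) auto
  then show ?thesis using homeomorphic_map_imp_homeomorphic_space by blast
qed

lemma metrizable_space_coordinates:
  fixes c :: "'i \<Rightarrow> 'a \<Rightarrow> real"
  assumes "compact_space K" "countable I" "\<And>i. i \<in> I \<Longrightarrow> continuous_map K euclideanreal (c i)"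
    and "\<And>x y. \<lbrakk>x \<in> topspace K; y \<in> topspace K; \<forall>i\<in>I. c i x = c i y\<rbrakk> \<Longrightarrow> x = y"
  shows "metrizable_space K"
proof -
  have "countable {i \<in> I. \<not> (\<exists>a. topspace (euclideanreal) \<subseteq> {a})}"
    using assms(2) by (rule countable_subset[rotated]) auto
  then have "metrizable_space (powertop_real I)"
    unfolding metrizable_space_product_topology using metrizable_space_euclidean by blast
  then show ?thesis
    using homeomorphic_powertop_real[of K I c] assms homeomorphic_metrizable_space
      metrizable_space_subtopology by (metis (no_types, lifting))
qed

text \<open>Supplies the neighbourhood hypothesis of
  \<open>finite_dimensional_space_coordinates\<close>. If no \<open>e\<close> works, the sets of
  counterexamples for \<open>e = 1/(n+1)\<close>, taken with weak inequalities, are closed, nonempty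
  and nested. A common point agrees with \<open>x\<close> in all coordinates, so it is
  \<open>x\<close>, yet it lies outside \<open>U\<close>.\<close>

lemma compact_coordinates_neighbourhood:
  fixes c :: "'i \<Rightarrow> 'a \<Rightarrow> real"
  assumes K: "compact_space K" and c: "\<And>i. i \<in> I \<Longrightarrow> continuous_map K euclideanreal (c i)"
    and inj: "\<And>x y. \<lbrakk>x \<in> topspace K; y \<in> topspace K; \<forall>i\<in>I. c i x = c i y\<rbrakk> \<Longrightarrow> x = y"
    and U: "openin K U" "x \<in> U"
  shows "\<exists>e>0. \<forall>y\<in>topspace K. (\<forall>i\<in>I. \<bar>c i y - c i x\<bar> < e) \<longrightarrow> y \<in> U"
proof (rule ccontr)
  define Q where "Q e \<longleftrightarrow> (\<forall>y\<in>topspace K. (\<forall>i\<in>I. \<bar>c i y - c i x\<bar> < e) \<longrightarrow> y \<in> U)" for e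
  assume "\<not> ?thesis"
  then have no: "\<not> (\<exists>e>0. Q e)" by (simp add: Q_def)
  define C where "C n = (topspace K - U) \<inter>
      (\<Inter>i\<in>I. {y \<in> topspace K. \<bar>c i y - c i x\<bar> \<le> inverse (real (Suc n))})" for n
  have "(\<Inter>n. C n) \<noteq> {}"
  proof (rule compact_space_imp_nest[OF K])
    fix n
    \<comment> \<open>An intersection over the empty index set is \<open>UNIV\<close>, so
      \<open>I = {}\<close> is a separate case.\<close>
    show "closedin K (C n)"
    proof (cases "I = {}")
      case False
      then show ?thesis unfolding C_def using U c
        by (intro closedin_Int closedin_INT closedin_real_le) (auto intro!: continuous_intros)
    qed (use U in \<open>auto simp: C_def\<close>)
    have "\<not> Q (inverse (real (Suc n)))" using no by simp
    then obtain y where "y \<in> topspace K" "\<forall>i\<in>I. \<bar>c i y - c i x\<bar> < inverse (real (Suc n))" "y \<notin> U"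
      unfolding Q_def by blast
    then show "C n \<noteq> {}" unfolding C_def by (auto intro: less_imp_le)
  next
    show "decseq C"
    proof (rule decseq_SucI)
      fix n
      have "inverse (real (Suc (Suc n))) \<le> inverse (real (Suc n))" by (simp add: field_simps)
      then have "t \<le> inverse (real (Suc n))" if "t \<le> inverse (real (Suc (Suc n)))" for t
        using that by linarith
      then show "C (Suc n) \<subseteq> C n" unfolding C_def by blast
    qed
  qed
  then obtain y where y: "\<And>n. y \<in> C n" by blast
  have yK: "y \<in> topspace K" "y \<notin> U" using y[of 0] by (auto simp: C_def)
  moreover have "\<bar>c i y - c i x\<bar> \<le> 0" if i: "i \<in> I" for i
  proof (rule field_le_epsilon)
    fix e :: real assume "0 < e"
    then obtain n where "inverse (real (Suc n)) < e" using reals_Archimedean by blast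
    moreover have "\<bar>c i y - c i x\<bar> \<le> inverse (real (Suc n))" using y[of n] i by (auto simp: C_def)
    ultimately show "\<bar>c i y - c i x\<bar> \<le> 0 + e" by linarith
  qed
  moreover have "x \<in> topspace K" using U openin_subset by blast
  ultimately have "y = x" by (intro inj) auto
  then show False using yK U by simp
qed

lemma omega_corson_iff_separating_family:
  assumes K: "compact_space K"
  shows "omega_corson K \<longleftrightarrow> (\<exists>F. separating_family K (topspace K) F)"
proof
  assume "omega_corson K"
  then obtain \<Gamma> :: "('a \<Rightarrow> real) set" and S where S: "S \<subseteq> topspace (finite_support_space \<Gamma>)"
    and hom: "K homeomorphic_space subtopology (finite_support_space \<Gamma>) S"
    unfolding omega_corson_def by blast
  then obtain h k where hk: "homeomorphic_maps K (subtopology (finite_support_space \<Gamma>) S) h k"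
    unfolding homeomorphic_space_def by blast
  define F where "F = (\<lambda>\<gamma>. \<lambda>a. h a \<gamma>) ` \<Gamma>"
  have ch: "continuous_map K (subtopology (finite_support_space \<Gamma>) S) h"
    and kh: "\<And>a. a \<in> topspace K \<Longrightarrow> k (h a) = a"
    using hk by (auto simp: homeomorphic_maps_def)
  have hS: "h a \<in> topspace (powertop_real \<Gamma>)" "finite {\<gamma> \<in> \<Gamma>. h a \<gamma> \<noteq> 0}"
    if "a \<in> topspace K" for a
    using continuous_map_image_subset_topspace[OF ch] that by (auto simp: finite_support_space_def)
  have "continuous_map K (powertop_real \<Gamma>) h"
    using ch by (simp add: finite_support_space_def continuous_map_in_subtopology)
  then have "\<forall>f\<in>F. continuous_map K euclideanreal f"
    by (auto simp: F_def continuous_map_componentwise)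
  moreover have "finite {f \<in> F. f x \<noteq> 0}" if x: "x \<in> topspace K" for x
  proof (rule finite_surj[OF hS(2)[OF x]])
    show "{f \<in> F. f x \<noteq> 0} \<subseteq> (\<lambda>\<gamma>. \<lambda>a. h a \<gamma>) ` {\<gamma> \<in> \<Gamma>. h x \<gamma> \<noteq> 0}" by (auto simp: F_def)
  qed
  moreover have "\<exists>f\<in>F. f x \<noteq> f y" if xy: "x \<in> topspace K" "y \<in> topspace K" "x \<noteq> y" for x y
  proof -
    have "h x \<noteq> h y" using kh xy by metis
    then obtain \<gamma> where \<gamma>: "h x \<gamma> \<noteq> h y \<gamma>" by blast
    \<comment> \<open>Points of the product are \<open>undefined\<close> outside
      \<open>\<Gamma>\<close>, so they can differ only at an index in
      \<open>\<Gamma>\<close>.\<close>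
    moreover have "h x \<gamma> = undefined" "h y \<gamma> = undefined" if "\<gamma> \<notin> \<Gamma>"
      using hS(1)[OF xy(1)] hS(1)[OF xy(2)] that by (auto simp: PiE_def extensional_def)
    ultimately have "\<gamma> \<in> \<Gamma>" by metis
    with \<gamma> show ?thesis by (auto simp: F_def)
  qed
  ultimately show "\<exists>F. separating_family K (topspace K) F" unfolding separating_family_def by blast
next
  assume "\<exists>F. separating_family K (topspace K) F"
  then obtain F where F: "separating_family K (topspace K) F" by blast
  let ?S = "(\<lambda>x. \<lambda>f\<in>F. f x) ` topspace K"
  have hom: "K homeomorphic_space subtopology (powertop_real F) ?S"
  proof (rule homeomorphic_powertop_real[OF K])
    show "continuous_map K euclideanreal f" if "f \<in> F" for f
      using F that by (simp add: separating_family_def)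
    show "x = y" if "x \<in> topspace K" "y \<in> topspace K" "\<forall>f\<in>F. f x = f y" for x y
      using F that unfolding separating_family_def by metis
  qed
  have S: "?S \<subseteq> topspace (finite_support_space F)"
  proof
    fix y assume "y \<in> ?S"
    then obtain x where x: "x \<in> topspace K" "y = (\<lambda>f\<in>F. f x)" by blast
    have "{f \<in> F. y f \<noteq> 0} = {f \<in> F. f x \<noteq> 0}" using x by auto
    then show "y \<in> topspace (finite_support_space F)"
      using F x by (auto simp: finite_support_space_def separating_family_def)
  qed
  moreover have "subtopology (finite_support_space F) ?S = subtopology (powertop_real F) ?S"
    using S by (simp add: finite_support_space_def subtopology_subtopology Int_absorb1)
  ultimately show "omega_corson K" unfolding omega_corson_def using hom by metis
qed

lemma omega_corson_imp_closure_preserving_cover: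
  assumes K: "compact_space K" and H: "Hausdorff_space K" and oc: "omega_corson K"
  shows "\<exists>\<A>. closure_preserving_in K \<A> \<and> \<Union>\<A> = topspace K \<and>
         (\<forall>A\<in>\<A>. compactin K A \<and> metrizable_space (subtopology K A) \<and>
                 finite_dimensional_space (subtopology K A))"
proof -
  obtain F where F: "separating_family K (topspace K) F"
    using oc omega_corson_iff_separating_family[OF K] by blast
  then have Fc: "\<And>f. f \<in> F \<Longrightarrow> continuous_map K euclideanreal f"
    and Ff: "\<And>x. x \<in> topspace K \<Longrightarrow> finite {f \<in> F. f x \<noteq> 0}"
    by (simp_all add: separating_family_def)
  have Fs: "x = y" if "x \<in> topspace K" "y \<in> topspace K" "\<forall>f\<in>F. f x = f y" for x y
    using F that unfolding separating_family_def by metis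
  define C where "C E = {x \<in> topspace K. \<forall>f\<in>F - E. f x = 0}" for E
  define \<A> where "\<A> = C ` {E. finite E \<and> E \<subseteq> F}"
  \<comment> \<open>Supports can only grow near a point: the finitely many functions that are
    nonzero at \<open>x\<close> stay nonzero nearby. So if a nearby \<open>y\<close> lies in
    \<open>C E\<close>, then the support of \<open>x\<close> is contained in \<open>E\<close>
    too.\<close>
  have clo: "closedin K (\<Union>\<B>)" if B: "\<B> \<subseteq> \<A>" for \<B>
  proof -
    have "openin K (topspace K - \<Union>\<B>)"
    proof (subst openin_subopen, intro ballI)
      fix x assume x: "x \<in> topspace K - \<Union>\<B>"
      let ?G = "{f \<in> F. f x \<noteq> 0}"
      let ?U = "{y \<in> topspace K. \<forall>f\<in>?G. 0 < \<bar>f y\<bar>}"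
      have "openin K ?U"
        using Ff x Fc by (intro openin_finite_Ball openin_real_less) (auto intro!: continuous_intros)
      moreover have "?U \<subseteq> topspace K - \<Union>\<B>"
      proof
        fix y assume y: "y \<in> ?U"
        have "y \<notin> B" if BB: "B \<in> \<B>" for B
        proof
          assume yB: "y \<in> B"
          obtain E where E: "B = C E" "E \<subseteq> F" using BB B by (auto simp: \<A>_def)
          have "?G \<subseteq> E" using y yB by (auto simp: E C_def)
          then have "x \<in> B" using x by (auto simp: E C_def)
          then show False using x BB by auto
        qed
        then show "y \<in> topspace K - \<Union>\<B>" using y by auto
      qed
      ultimately show "\<exists>T. openin K T \<and> x \<in> T \<and> T \<subseteq> topspace K - \<Union>\<B>"
        using x by (intro exI[of _ ?U]) auto
    qed
    moreover have "\<Union>\<B> \<subseteq> topspace K" using B by (auto simp: \<A>_def C_def)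
    ultimately show ?thesis by (simp add: closedin_def)
  qed
  have clo1: "closedin K A" if "A \<in> \<A>" for A using clo[of "{A}"] that by simp
  have "closure_preserving_in K \<A>"
    unfolding closure_preserving_in_def
  proof (intro conjI allI impI ballI)
    fix \<B> assume B: "\<B> \<subseteq> \<A>"
    have "K closure_of (\<Union>\<B>) = \<Union>\<B>" using clo[OF B] by (rule closure_of_closedin)
    also have "\<dots> = (\<Union>A\<in>\<B>. K closure_of A)"
    proof -
      have "K closure_of A = A" if "A \<in> \<B>" for A using clo1 B that by (intro closure_of_closedin) blast
      then show ?thesis by auto
    qed
    finally show "K closure_of (\<Union>\<B>) = (\<Union>A\<in>\<B>. K closure_of A)" .
  qed (use clo1 closedin_subset in blast)
  moreover have "\<Union>\<A> = topspace K"
  proof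
    show "topspace K \<subseteq> \<Union>\<A>"
    proof
      fix x assume x: "x \<in> topspace K"
      then have "x \<in> C {f \<in> F. f x \<noteq> 0}" "C {f \<in> F. f x \<noteq> 0} \<in> \<A>"
        using Ff by (auto simp: C_def \<A>_def)
      then show "x \<in> \<Union>\<A>" by blast
    qed
  qed (auto simp: \<A>_def C_def)
  moreover have "compactin K A \<and> metrizable_space (subtopology K A) \<and>
                 finite_dimensional_space (subtopology K A)" if A: "A \<in> \<A>" for A
  proof -
    obtain E where E: "A = C E" "finite E" "E \<subseteq> F" using A by (auto simp: \<A>_def)
    have cA: "compactin K A" using clo1[OF A] K by (rule closedin_compact_space[rotated])
    then have csA: "compact_space (subtopology K A)" by (rule compact_space_subtopology)
    have top: "topspace (subtopology K A) = A" using clo1[OF A] closedin_subset by (metis topspace_subtopology_subset)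
    have c: "\<And>f. f \<in> E \<Longrightarrow> continuous_map (subtopology K A) euclideanreal f"
      using Fc E by (blast intro: continuous_map_from_subtopology)
    \<comment> \<open>Functions outside \<open>E\<close> vanish on \<open>A\<close>, so
      \<open>E\<close> alone separates its points; these finitely many coordinates give both
      metrizability and finite dimension.\<close>
    have inj: "x = y" if xy: "x \<in> topspace (subtopology K A)" "y \<in> topspace (subtopology K A)" "\<forall>f\<in>E. f x = f y" for x y
    proof (rule Fs)
      show "\<forall>f\<in>F. f x = f y"
      proof
        fix f assume f: "f \<in> F"
        have "f x = 0 \<and> f y = 0" if "f \<notin> E"
          using xy(1,2) f that unfolding top E(1) C_def by simp
        then show "f x = f y" using xy(3) by (cases "f \<in> E") simp_all
      qed
    qed (use xy in auto)
    have "metrizable_space (subtopology K A)"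
      by (rule metrizable_space_coordinates[OF csA countable_finite[OF E(2)] c inj])
    moreover have "finite_dimensional_space (subtopology K A)"
      using finite_dimensional_space_coordinates[of E "subtopology K A" "\<lambda>f. f"] E(2) c
        compact_coordinates_neighbourhood[of "subtopology K A" E "\<lambda>f. f"] csA inj by blast
    ultimately show ?thesis using cA by simp
  qed
  ultimately show ?thesis by blast
qed

section \<open>Point-finite cozero covers\<close>

unbundle cardinal_syntax

section \<open>Uniform limits, cardinal estimates and Urysohn functions\<close>

lemma continuous_map_real_uniform_limit:
  fixes f :: "nat \<Rightarrow> 'a \<Rightarrow> real"
  assumes f: "\<And>n. continuous_map X euclideanreal (f n)"
    and b: "\<And>n x. x \<in> topspace X \<Longrightarrow> \<bar>f n x - g x\<bar> \<le> b n" and lim: "b \<longlonglongrightarrow> 0"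
  shows "continuous_map X euclideanreal g"
proof -
  have "continuous_map X Met_TC.mtopology g"
  proof (rule Met_TC.continuous_map_uniform_limit[where f=f and F=sequentially])
    fix e :: real assume "0 < e"
    then have "\<forall>\<^sub>F n in sequentially. b n < e" using lim by (rule order_tendstoD(2)[rotated])
    then show "\<forall>\<^sub>F n in sequentially. \<forall>x\<in>topspace X. g x \<in> UNIV \<and> dist (f n x) (g x) < e"
      by (rule eventually_mono) (use b in \<open>auto simp: dist_real_def intro: le_less_trans\<close>)
  qed (use f in auto)
  then show ?thesis by simp
qed

text \<open>Keeps families of witnesses, which are indexed by finite lists of functions, as small as
  the stock of functions.\<close>

lemma card_of_lists_ordLeq_infinite:
  assumes B: "infinite B" and X: "|X| \<le>o |B|"
  shows "|lists X| \<le>o |B|"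
proof -
  have n: "|{l \<in> lists X. length l = n}| \<le>o |B|" for n
  proof (induction n)
    case 0
    have "{l \<in> lists X. length l = 0} = {[]}" by auto
    moreover have "B \<noteq> {}" using B by auto
    ultimately show ?case by (simp add: card_of_singl_ordLeq)
  next
    case (Suc n)
    have "{l \<in> lists X. length l = Suc n} = (\<lambda>(x, l). x # l) ` (X \<times> {l \<in> lists X. length l = n})"
      by (auto simp: length_Suc_conv image_iff)
    moreover have "|X \<times> {l \<in> lists X. length l = n}| \<le>o |B|"
      using Suc by (intro card_of_Sigma_ordLeq_infinite[OF B X]) simp
    ultimately show ?case by (simp only:) (rule ordLeq_transitive[OF card_of_image])
  qed
  have "|UNIV :: nat set| \<le>o |B|" using B infinite_iff_card_of_nat by blast
  then have "|\<Union>n\<in>UNIV. {l \<in> lists X. length l = n}| \<le>o |B|"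
    using n by (intro card_of_UNION_ordLeq_infinite[OF B]) auto
  moreover have "(\<Union>n\<in>UNIV. {l \<in> lists X. length l = n}) = lists X" by auto
  ultimately show ?thesis by simp
qed

lemma card_of_Un_ordLeq_infinite:
  assumes "infinite B" "|X| \<le>o |B|" "|Y| \<le>o |B|"
  shows "|X \<union> Y| \<le>o |B|"
  using card_of_Un_ordLeq_infinite_Field[of "|B|" X Y] assms
  by (simp add: Field_card_of card_of_Card_order card_of_card_order_on)

lemma Urysohn_zero_one:
  assumes "compact_space K" "Hausdorff_space K" "closedin K S" "closedin K T" "S \<inter> T = {}"
  obtains f where "continuous_map K euclideanreal f" "\<And>x. x \<in> topspace K \<Longrightarrow> 0 \<le> f x \<and> f x \<le> (1::real)"
    "\<And>x. x \<in> S \<Longrightarrow> f x = 0" "\<And>x. x \<in> T \<Longrightarrow> f x = 1"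
proof -
  have "normal_space K" using assms compact_Hausdorff_or_regular_imp_normal_space by blast
  then obtain f where f: "continuous_map K (top_of_set {0..1::real}) f" "f ` S \<subseteq> {0}" "f ` T \<subseteq> {1}"
    using Urysohn_lemma[of K S T 0 1] assms by (auto simp: disjnt_def)
  show thesis
  proof (rule that[of f])
    show "continuous_map K euclideanreal f" using f(1) by (simp add: continuous_map_in_subtopology)
    show "0 \<le> f x \<and> f x \<le> 1" if "x \<in> topspace K" for x
      using f(1) that by (force simp: continuous_map_in_subtopology)
  qed (use f in auto)
qed

section \<open>Cozero covers by induction on cardinality\<close>

text \<open>\<open>G\<close> is what has been dealt with already, so new functions vanish there and
  need to be positive only on \<open>S - G\<close>. Point-finiteness is demanded on the whole space
  and not only on \<open>S\<close>, because functions belonging to different sets \<open>S\<close>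
  are collected later.\<close>

definition cozero_cover :: "'a topology \<Rightarrow> 'a set \<Rightarrow> 'a set \<Rightarrow> ('a \<Rightarrow> real) set \<Rightarrow> bool" where
  "cozero_cover K G S F \<longleftrightarrow>
     (\<forall>f\<in>F. continuous_map K euclideanreal f \<and> (\<forall>x\<in>topspace K. 0 \<le> f x) \<and> (\<forall>x\<in>G. f x = 0)) \<and>
     (\<forall>x\<in>topspace K. finite {f \<in> F. 0 < f x}) \<and>
     (\<forall>x\<in>S - G. \<exists>f\<in>F. 0 < f x)"

lemma cozero_coverD:
  assumes "cozero_cover K G S F"  "f \<in> F"
  shows "continuous_map K euclideanreal f" "x \<in> topspace K \<Longrightarrow> 0 \<le> f x" "x \<in> G \<Longrightarrow> f x = 0"
  using assms by (simp_all add: cozero_cover_def)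

text \<open>One function suffices: the sum of Urysohn functions for the sets \<open>C n\<close> with
  weights \<open>(1/2)^n\<close>. The tail after \<open>n\<close> terms is at most
  \<open>2 * (1/2)^n\<close>, so the convergence is uniform.\<close>

lemma cozero_cover_sigma_closed:
  fixes C :: "nat \<Rightarrow> 'a set"
  assumes K: "compact_space K" "Hausdorff_space K" and G: "closedin K G"
    and C: "\<And>n. closedin K (C n)" and S: "S - G = (\<Union>n. C n)"
  shows "\<exists>f. cozero_cover K G S {f}"
proof -
  have "\<exists>f. continuous_map K euclideanreal f \<and> (\<forall>x\<in>topspace K. 0 \<le> f x \<and> f x \<le> (1::real)) \<and>
      (\<forall>x\<in>G. f x = 0) \<and> (\<forall>x\<in>C n. f x = 1)" for n
  proof -
    have "G \<inter> C n = {}" using S by blast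
    then show ?thesis using Urysohn_zero_one[OF K G C] by metis
  qed
  then obtain u where u: "\<And>n. continuous_map K euclideanreal (u n)"
    "\<And>n x. x \<in> topspace K \<Longrightarrow> 0 \<le> u n x \<and> u n x \<le> 1"
    "\<And>n x. x \<in> G \<Longrightarrow> u n x = 0" "\<And>n x. x \<in> C n \<Longrightarrow> u n x = (1::real)" by metis
  define f where "f x = (\<Sum>n. (1/2)^n * u n x)" for x
  have sm: "summable (\<lambda>n. (1/2)^n * u n x)" if "x \<in> topspace K" for x
  proof (rule summable_comparison_test')
    show "summable (\<lambda>n. (1/2::real)^n)" by simp
    show "norm ((1/2)^n * u n x) \<le> (1/2)^n" if "n \<ge> 0" for n
      using u(2)[OF \<open>x \<in> topspace K\<close>, of n] by (simp add: abs_mult mult_left_le)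
  qed
  have "continuous_map K euclideanreal f"
  proof (rule continuous_map_real_uniform_limit)
    show "continuous_map K euclideanreal (\<lambda>x. \<Sum>i<n. (1/2)^i * u i x)" for n
      using u(1) by (intro continuous_intros) auto
    show "(\<lambda>n. 2 * (1/2::real)^n) \<longlonglongrightarrow> 0"
      by (intro tendsto_mult_right_zero LIMSEQ_power_zero) simp
    fix n x assume x: "x \<in> topspace K"
    have sm1: "summable (\<lambda>i. (1/2)^(i+n) * u (i+n) x)"
      using sm[OF x] by (rule summable_ignore_initial_segment)
    have sm2: "summable (\<lambda>i. (1/2::real)^(i+n))"
      by (rule summable_ignore_initial_segment) simp
    have eq: "f x = (\<Sum>i. (1/2)^(i+n) * u (i+n) x) + (\<Sum>i<n. (1/2)^i * u i x)"
      unfolding f_def using sm[OF x] by (rule suminf_split_initial_segment)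
    have "(\<Sum>i. (1/2)^(i+n) * u (i+n) x) \<le> (\<Sum>i. (1/2)^(i+n))"
      using u(2)[OF x] by (intro suminf_le sm1 sm2) (simp add: mult_left_le)
    also have "\<dots> = (\<Sum>i. (1/2)^n * (1/2::real)^i)" by (simp add: power_add mult.commute)
    also have "\<dots> = (1/2)^n * (\<Sum>i. (1/2::real)^i)" by (rule suminf_mult) simp
    also have "\<dots> = 2 * (1/2)^n" by (simp add: suminf_geometric)
    finally have "(\<Sum>i. (1/2)^(i+n) * u (i+n) x) \<le> 2 * (1/2)^n" .
    moreover have "0 \<le> (\<Sum>i. (1/2)^(i+n) * u (i+n) x)"
      using u(2)[OF x] by (intro suminf_nonneg sm1) simp
    ultimately show "\<bar>(\<Sum>i<n. (1/2)^i * u i x) - f x\<bar> \<le> 2 * (1/2)^n" using eq by linarith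
  qed
  moreover have "0 \<le> f x" if "x \<in> topspace K" for x
    unfolding f_def using u(2) that by (intro suminf_nonneg sm) auto
  moreover have "f x = 0" if "x \<in> G" for x using u(3) that by (simp add: f_def)
  moreover have "0 < f x" if x: "x \<in> S - G" for x
  proof -
    obtain n where n: "x \<in> C n" using x S by blast
    then have xK: "x \<in> topspace K" using C closedin_subset by blast
    have "0 < (1/2)^n * u n x" using u(4)[OF n] by simp
    then show ?thesis
      unfolding f_def using u(2)[OF xK] by (intro suminf_pos2[OF sm[OF xK]]) auto
  qed
  ultimately have "cozero_cover K G S {f}" unfolding cozero_cover_def by simp
  then show ?thesis by blast
qed

text \<open>The finite intersection property needs closed sets, so strict positivity is replaced by
  superlevel sets at fixed thresholds \<open>e f\<close>, one for each function.\<close>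

lemma finite_accumulation_cozero:
  assumes K: "compact_space K" and S: "closedin K S"
    and cont: "\<And>f. f \<in> I \<Longrightarrow> continuous_map K euclideanreal f"
    and e: "\<And>f. f \<in> I \<Longrightarrow> 0 < (e f :: real)"
    and wit: "\<And>E. finite E \<Longrightarrow> E \<subseteq> I \<Longrightarrow> \<exists>x\<in>S. \<forall>f\<in>E. e f \<le> f x"
  shows "\<exists>x\<in>S. \<forall>f\<in>I. 0 < f x"
proof -
  define C where "C f = {x \<in> topspace K. e f \<le> f x}" for f
  have "compactin K S" using K S by (rule closedin_compact_space)
  moreover have "\<forall>A\<in>C ` I. closedin K A"
    unfolding C_def using cont by (auto intro!: closedin_real_le)
  moreover have "S \<inter> \<Inter>\<F> \<noteq> {}" if F: "finite \<F>" "\<F> \<subseteq> C ` I" for \<F>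
  proof -
    obtain E where E: "E \<subseteq> I" "finite E" "\<F> = C ` E" using F by (meson finite_subset_image)
    obtain x where x: "x \<in> S" "\<forall>f\<in>E. e f \<le> f x" using wit[OF E(2,1)] by blast
    have "x \<in> topspace K" using x S closedin_subset by blast
    then have "x \<in> S \<inter> \<Inter>\<F>" using x by (auto simp: E(3) C_def)
    then show ?thesis by blast
  qed
  ultimately have "S \<inter> \<Inter>(C ` I) \<noteq> {}" unfolding compactin_fip by meson
  then obtain x where "x \<in> S" "\<forall>f\<in>I. x \<in> C f" by blast
  then have "\<forall>f\<in>I. 0 < f x" using e by (fastforce simp: C_def)
  with \<open>x \<in> S\<close> show ?thesis by blast
qed

text \<open>Induction on the cardinality of \<^term>\<open>\<Z>\<close>. A countable union of members minus \<^term>\<open>G\<close> is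
  sigma-compact. An uncountable \<^term>\<open>\<Z>\<close> is exhausted by a continuous chain of smaller subfamilies
  \<^term>\<open>M z\<close>; the functions added at stage \<^term>\<open>z\<close> vanish on everything reached before, and
  \<^term>\<open>M z\<close> contains witnesses for all nonempty finite intersections of superlevel sets of the earlier
  functions. If infinitely many functions of a limit stage were positive at one point, compactness of
  the union of the stage would move that point into the union, hence into an earlier stage, where
  almost all of those functions vanish.\<close>
lemma cozero_cover_of_closed_family:
  assumes K: "compact_space K" "Hausdorff_space K"
    and clo: "\<And>\<B>. \<B> \<subseteq> \<A> \<Longrightarrow> closedin K (\<Union>\<B>)"
    and sig: "\<And>A G. A \<in> \<A> \<Longrightarrow> closedin K G \<Longrightarrow>
          \<exists>C::nat \<Rightarrow> 'a set. (\<forall>n. closedin K (C n)) \<and> A - G = (\<Union>n. C n)"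
    and cov: "\<Union>\<A> = topspace K"
    and Z: "\<Z> \<subseteq> \<A>" and G: "closedin K G"
  shows "\<exists>F. |F| \<le>o |\<Z> <+> (UNIV :: nat set)| \<and> cozero_cover K G (\<Union>\<Z>) F"
  using Z G
proof (induction "|\<Z>|" arbitrary: \<Z> G rule: wf_induct_rule[OF wf_ordLess])
  case 1
  note Z = \<open>\<Z> \<subseteq> \<A>\<close> and G = \<open>closedin K G\<close>
  \<comment> \<open>The bound on \<open>|F|\<close> is part of the induction because a stage has to
    contain a witness for every finite list of earlier functions and still be smaller than
    \<open>\<Z>\<close>. The summand \<open>nat\<close> keeps the bound infinite for finite
    families.\<close>
  have IH: "\<exists>F. |F| \<le>o |\<Y> <+> (UNIV :: nat set)| \<and> cozero_cover K H (\<Union>\<Y>) F"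
    if "|\<Y>| <o |\<Z>|" "\<Y> \<subseteq> \<A>" "closedin K H" for \<Y> H
    using "1.hyps" that by blast
  show ?case
  proof (cases "countable \<Z>")
    case True
    show ?thesis
    proof (cases "\<Z> = {}")
      case True
      have "|{} :: ('a \<Rightarrow> real) set| \<le>o |\<Z> <+> (UNIV :: nat set)|" by (rule card_of_empty)
      moreover have "cozero_cover K G (\<Union>\<Z>) {}" using True by (simp add: cozero_cover_def)
      ultimately show ?thesis by blast
    next
      case False
      define A where "A n = from_nat_into \<Z> n" for n
      have A: "\<Z> = range A" unfolding A_def using \<open>countable \<Z>\<close> False by simp
      then have "\<exists>C::nat \<Rightarrow> 'a set. (\<forall>n. closedin K (C n)) \<and> A m - G = (\<Union>n. C n)" for m
        using sig[OF _ G] Z by blast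
      then obtain C where C: "\<And>m n. closedin K (C m n)" "\<And>m. A m - G = (\<Union>n. C m (n::nat))" by metis
      define C' where "C' k = (case prod_decode k of (m, n) \<Rightarrow> C m n)" for k
      have "\<Union>\<Z> - G = (\<Union>k. C' k)"
      proof -
        have "\<Union>\<Z> - G = (\<Union>m. A m - G)" using A by blast
        also have "\<dots> = (\<Union>m n. C m n)" using C(2) by simp
        also have "\<dots> = (\<Union>k. C' k)"
        proof (intro equalityI subsetI)
          fix x assume "x \<in> (\<Union>m n. C m n)"
          then obtain m n where "x \<in> C m n" by blast
          then have "x \<in> C' (prod_encode (m, n))" by (simp add: C'_def)
          then show "x \<in> (\<Union>k. C' k)" by blast
        next
          fix x assume "x \<in> (\<Union>k. C' k)"
          then obtain k where "x \<in> C' k" by blast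
          then have "x \<in> C (fst (prod_decode k)) (snd (prod_decode k))" by (simp add: C'_def split_beta)
          then show "x \<in> (\<Union>m n. C m n)" by blast
        qed
        finally show ?thesis .
      qed
      moreover have "closedin K (C' k)" for k using C(1) by (simp add: C'_def split: prod.split)
      ultimately have "\<exists>f. cozero_cover K G (\<Union>\<Z>) {f}"
        by (intro cozero_cover_sigma_closed[OF K G, of C'])
      then obtain f where f: "cozero_cover K G (\<Union>\<Z>) {f}" by blast
      have "|{f}| \<le>o |\<Z> <+> (UNIV :: nat set)|" by (rule card_of_singl_ordLeq) auto
      with f show ?thesis by blast
    qed
  next
    case unc: False
    then have Zinf: "infinite \<Z>" using countable_finite by blast
    have "\<not> |\<Z>| \<le>o |UNIV :: nat set|"
      using unc unfolding card_of_ordLeq[symmetric] countable_def by blast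
    then have natZ: "|UNIV :: nat set| <o |\<Z>|"
      by (simp add: not_ordLeq_iff_ordLess card_of_Well_order)
    define R where "R = |\<Z>| - Id"
    define lo where "lo z = {y. (y, z) \<in> R}" for z
    have wo: "well_order_on \<Z> |\<Z>|" by (rule card_of_well_order_on)
    then have wfR: "wf R" by (simp add: R_def well_order_on_def)
    have trR: "(x, z) \<in> R" if "(x, y) \<in> R" "(y, z) \<in> R" for x y z
    proof -
      have "trans |\<Z>|" "antisym |\<Z>|"
        using wo unfolding well_order_on_def linear_order_on_def partial_order_on_def preorder_on_def by auto
      with that show ?thesis unfolding R_def by (auto dest: transD antisymD)
    qed
    have totR: "(x, y) \<in> R \<or> (y, x) \<in> R \<or> x = y" if "x \<in> \<Z>" "y \<in> \<Z>" for x y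
      using wo that unfolding well_order_on_def linear_order_on_def total_on_def R_def by auto
    have loZ: "lo z \<subseteq> \<Z>" for z
      using Field_card_of[of \<Z>] by (auto simp: lo_def R_def Field_def)
    have lo_card: "|lo z| <o |\<Z>|" if "z \<in> \<Z>" for z
    proof -
      have "lo z = underS |\<Z>| z" by (auto simp: lo_def R_def underS_def)
      then show ?thesis using card_of_underS[OF card_of_Card_order, of z \<Z>] that by (simp add: Field_card_of)
    qed
    \<comment> \<open>A list of pairs \<open>(f, n)\<close> encodes a finite intersection of
      superlevel sets. It is assigned a member that meets this intersection, or an arbitrary member
      if the intersection is empty. The member is taken from \<open>\<A>\<close> and not from
      \<open>\<Z>\<close>, since the point may lie anywhere in \<open>K\<close>.\<close>
    have "\<exists>A\<in>\<A>. (\<exists>x\<in>topspace K. \<forall>(f, n)\<in>set l. inverse (real (Suc n)) < f x) \<longrightarrow>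
        (\<exists>x\<in>A. \<forall>(f, n)\<in>set l. inverse (real (Suc n)) < f x)" for l :: "(('a \<Rightarrow> real) \<times> nat) list"
    proof (cases "\<exists>x\<in>topspace K. \<forall>(f, n)\<in>set l. inverse (real (Suc n)) < f x")
      case True
      then obtain x where "x \<in> topspace K" "\<forall>(f, n)\<in>set l. inverse (real (Suc n)) < f x" by blast
      with cov show ?thesis by blast
    next
      case False
      have "\<A> \<noteq> {}" using Zinf Z by auto
      with False show ?thesis by blast
    qed
    then obtain wit where witA: "\<And>l. wit l \<in> \<A>" and wit: "\<And>l :: (('a \<Rightarrow> real) \<times> nat) list.
        \<exists>x\<in>topspace K. \<forall>(f, n)\<in>set l. inverse (real (Suc n)) < f x \<Longrightarrow>
        \<exists>x\<in>wit l. \<forall>(f, n)\<in>set l. inverse (real (Suc n)) < f x" by metis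
    define W where "W V = wit ` lists (V \<times> UNIV)" for V
    \<comment> \<open>The recursion builds pairs \<open>(M z, N z)\<close>. The premises on
      \<open>fst p\<close> make a choice possible at every \<open>z\<close>, before it is known that
      the stages stay small; \<open>size\<close> discharges them afterwards for
      \<open>z \<in> \<Z>\<close>.\<close>
    define P where "P h z p \<longleftrightarrow>
        fst p = (\<Union>y\<in>lo z. fst (h y)) \<union> {z} \<union> W (\<Union>y\<in>lo z. snd (h y)) \<and>
        ( |fst p| <o |\<Z>| \<longrightarrow> fst p \<subseteq> \<A> \<longrightarrow> |snd p| \<le>o |fst p <+> (UNIV :: nat set)| \<and>
          cozero_cover K (G \<union> \<Union>(\<Union>y\<in>lo z. fst (h y))) (\<Union>(fst p)) (snd p))" 
      for h :: "'a set \<Rightarrow> 'a set set \<times> ('a \<Rightarrow> real) set" and z p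
    have "\<exists>h. \<forall>z. P h z (h z)"
    proof (rule dependent_wf_choice[OF wfR])
      fix f g :: "'a set \<Rightarrow> 'a set set \<times> ('a \<Rightarrow> real) set" and x r
      assume "\<And>z. (z, x) \<in> R \<Longrightarrow> f z = g z"
      then have "(\<Union>y\<in>lo x. fst (f y)) = (\<Union>y\<in>lo x. fst (g y))"
        "(\<Union>y\<in>lo x. snd (f y)) = (\<Union>y\<in>lo x. snd (g y))" by (simp_all add: lo_def)
      then show "P f x r = P g x r" unfolding P_def by (simp only:)
    next
      fix x and f :: "'a set \<Rightarrow> 'a set set \<times> ('a \<Rightarrow> real) set"
      define m where "m = (\<Union>y\<in>lo x. fst (f y)) \<union> {x} \<union> W (\<Union>y\<in>lo x. snd (f y))"
      show "\<exists>r. P f x r"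
      proof (cases "|m| <o |\<Z>| \<and> m \<subseteq> \<A>")
        case True
        then have "closedin K (G \<union> \<Union>(\<Union>y\<in>lo x. fst (f y)))"
          by (intro closedin_Un G clo) (auto simp: m_def)
        then obtain N where "|N| \<le>o |m <+> (UNIV :: nat set)|"
          "cozero_cover K (G \<union> \<Union>(\<Union>y\<in>lo x. fst (f y))) (\<Union>m) N" using IH True by blast
        then have "P f x (m, N)" unfolding P_def m_def by simp
        then show ?thesis by blast
      next
        case False
        then have "P f x (m, {})" unfolding P_def m_def by auto
        then show ?thesis by blast
      qed
    qed
    then obtain h where h: "\<And>z. P h z (h z)" by blast
    define M where "M z = fst (h z)" for z
    define N where "N z = snd (h z)" for z
    have M_eq: "M z = (\<Union>y\<in>lo z. M y) \<union> {z} \<union> W (\<Union>y\<in>lo z. N y)" for z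
      using h[of z] unfolding P_def M_def N_def by simp
    have N: "|N z| \<le>o |M z <+> (UNIV :: nat set)|"
        "cozero_cover K (G \<union> \<Union>(\<Union>y\<in>lo z. M y)) (\<Union>(M z)) (N z)" if "|M z| <o |\<Z>|" "M z \<subseteq> \<A>" for z
      using h[of z] that unfolding P_def M_def N_def by auto
    \<comment> \<open>Everything is counted by \<open>lo z\<close>. In the cardinal order this
      initial segment is smaller than \<open>\<Z>\<close>, and adding \<open>nat\<close> keeps it
      smaller because \<open>\<Z>\<close> is uncountable.\<close>
    have size: "M z \<subseteq> \<A> \<and> |M z| \<le>o |lo z <+> (UNIV :: nat set)| \<and> |N z| \<le>o |lo z <+> (UNIV :: nat set)|
        \<and> |M z| <o |\<Z>|" if "z \<in> \<Z>" for z
      using wfR that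
    proof (induction z rule: wf_induct_rule)
      case (less z)
      let ?B = "lo z <+> (UNIV :: nat set)"
      have B: "infinite ?B" by simp
      have yz: "M y \<subseteq> \<A>" "|M y| \<le>o |?B|" "|N y| \<le>o |?B|" if y: "y \<in> lo z" for y
      proof -
        have "lo y \<subseteq> lo z" using y trR by (auto simp: lo_def)
        then have "lo y <+> (UNIV :: nat set) \<subseteq> ?B" by blast
        then have le: "|lo y <+> (UNIV :: nat set)| \<le>o |?B|" by (rule card_of_mono1)
        have "M y \<subseteq> \<A> \<and> |M y| \<le>o |lo y <+> (UNIV :: nat set)| \<and> |N y| \<le>o |lo y <+> (UNIV :: nat set)|"
          using less.IH[of y] y loZ by (auto simp: lo_def)
        then show "M y \<subseteq> \<A>" "|M y| \<le>o |?B|" "|N y| \<le>o |?B|" using le ordLeq_transitive by blast+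
      qed
      have loB: "|lo z| \<le>o |?B|" by (rule card_of_Plus1)
      have 1: "|\<Union>y\<in>lo z. M y| \<le>o |?B|" "|\<Union>y\<in>lo z. N y| \<le>o |?B|"
        using yz by (auto intro!: card_of_UNION_ordLeq_infinite[OF B loB])
      have "|(\<Union>y\<in>lo z. N y) \<times> (UNIV :: nat set)| \<le>o |?B|"
        by (intro card_of_Sigma_ordLeq_infinite[OF B 1(2)]) (simp add: card_of_Plus2)
      then have "|lists ((\<Union>y\<in>lo z. N y) \<times> (UNIV :: nat set))| \<le>o |?B|"
        by (rule card_of_lists_ordLeq_infinite[OF B])
      then have 2: "|W (\<Union>y\<in>lo z. N y)| \<le>o |?B|"
        unfolding W_def by (rule ordLeq_transitive[OF card_of_image])
      have 3: "|{z}| \<le>o |?B|" by (rule card_of_singl_ordLeq) auto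
      have Mle: "|M z| \<le>o |?B|"
        by (subst M_eq) (intro card_of_Un_ordLeq_infinite[OF B] 1 2 3)
      moreover have "|?B| <o |\<Z>|"
        by (rule card_of_Plus_ordLess_infinite[OF Zinf lo_card[OF less.prems] natZ])
      ultimately have Mlt: "|M z| <o |\<Z>|" by (rule ordLeq_ordLess_trans)
      have MA: "M z \<subseteq> \<A>"
        by (subst M_eq) (use yz witA less.prems Z in \<open>auto simp: W_def\<close>)
      have "|M z <+> (UNIV :: nat set)| \<le>o |?B|"
        by (rule card_of_Plus_ordLeq_infinite_Field)
          (use B Mle card_of_Plus2 in \<open>simp_all add: Field_card_of card_of_card_order_on\<close>)
      with N(1)[OF Mlt MA] have "|N z| \<le>o |?B|" by (rule ordLeq_transitive)
      with MA Mle Mlt show ?case by simp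
    qed
    have Ncov: "cozero_cover K (G \<union> \<Union>(\<Union>y\<in>lo z. M y)) (\<Union>(M z)) (N z)" if "z \<in> \<Z>" for z
      using N(2) size[OF that] by blast
    have Ncont: "continuous_map K euclideanreal f" and Nnonneg: "\<And>x. x \<in> topspace K \<Longrightarrow> 0 \<le> f x"
      and NG: "\<And>x. x \<in> G \<Longrightarrow> f x = 0"
      and Nlo: "\<And>x y A. y \<in> lo z \<Longrightarrow> A \<in> M y \<Longrightarrow> x \<in> A \<Longrightarrow> f x = 0" if "z \<in> \<Z>" "f \<in> N z" for z f
    proof -
      note * = cozero_coverD[OF Ncov[OF that(1)] that(2)]
      show "continuous_map K euclideanreal f" by (fact *(1))
      show "0 \<le> f x" if "x \<in> topspace K" for x using *(2) that .
      show "f x = 0" if "x \<in> G" for x using *(3) that by simp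
      show "f x = 0" if "y \<in> lo z" "A \<in> M y" "x \<in> A" for x y A
        using that by (intro *(3)) blast
    qed
    have M_mono: "M y \<subseteq> M z" if "y \<in> lo z" for y z
      using M_eq[of z] that by blast
    define up where "up z = insert z (lo z)" for z
    define V where "V J = (\<Union>z\<in>J. N z)" for J
    \<comment> \<open>Used twice: with \<open>J = lo z\<close> in the induction for
      \<open>pf\<close>, and with \<open>J = \<Z>\<close> for the final family.\<close>
    have limit: "finite {f \<in> V J. 0 < f x}"
      if J: "J \<subseteq> \<Z>" "\<And>z. z \<in> J \<Longrightarrow> lo z \<subseteq> J"
        and below: "\<And>z x. z \<in> J \<Longrightarrow> x \<in> topspace K \<Longrightarrow> finite {f \<in> V (up z). 0 < f x}"
        and x: "x \<in> topspace K" for J x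
    proof (rule ccontr)
      let ?I = "{f \<in> V J. 0 < f x}"
      assume inf: "infinite ?I"
      let ?S = "\<Union>(\<Union>z\<in>J. M z)"
      have Sclo: "closedin K ?S" using size J(1) by (intro clo) blast
      have "\<exists>n. inverse (real (Suc n)) < f x" if "f \<in> ?I" for f
        using that reals_Archimedean by blast
      then obtain n where n: "\<And>f. f \<in> ?I \<Longrightarrow> inverse (real (Suc (n f))) < f x" by metis
      have "\<exists>w\<in>?S. \<forall>f\<in>?I. 0 < f w"
      proof (rule finite_accumulation_cozero[OF K(1) Sclo])
        show "continuous_map K euclideanreal f" if "f \<in> ?I" for f
          using that Ncont J(1) by (auto simp: V_def)
        show "0 < inverse (real (Suc (n f)))" for f by simp
        fix E assume E: "finite E" "E \<subseteq> ?I"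
        have "\<exists>z\<in>J. E \<subseteq> V (up z)" if "E \<noteq> {}"
          using E(1) that E(2)
        proof (induction E rule: finite_ne_induct)
          case (singleton f)
          then show ?case by (auto simp: V_def up_def)
        next
          case (insert f E)
          then obtain z where z: "z \<in> J" "E \<subseteq> V (up z)" by auto
          obtain y where y: "y \<in> J" "f \<in> N y" using insert.prems by (auto simp: V_def)
          have "(y, z) \<in> R \<or> (z, y) \<in> R \<or> y = z" using totR z y J by blast
          then show ?case
          proof (elim disjE)
            assume "(z, y) \<in> R"
            then have "up z \<subseteq> up y" using trR by (auto simp: up_def lo_def)
            then have "insert f E \<subseteq> V (up y)" using z y unfolding V_def up_def by blast
            with y show ?thesis by blast
          next
            assume "(y, z) \<in> R"
            then have "insert f E \<subseteq> V (up z)" using z y unfolding V_def up_def lo_def by blast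
            with z show ?thesis by blast
          next
            assume "y = z"
            then have "insert f E \<subseteq> V (up z)" using z y unfolding V_def up_def lo_def by blast
            with z show ?thesis by blast
          qed
        qed
        moreover have "J \<noteq> {}" using inf by (auto simp: V_def)
        ultimately obtain z where z: "z \<in> J" "E \<subseteq> V (up z)" by (cases "E = {}") auto
        \<comment> \<open>\<open>M y\<close> holds witnesses only for lists of functions from stages
          strictly below \<open>y\<close>, so a stage beyond \<open>z\<close> is needed. It exists
          since \<open>up z\<close> contributes only finitely many functions positive at
          \<open>x\<close>, while \<open>?I\<close> is infinite.\<close>
        have "\<not> ?I \<subseteq> {f \<in> V (up z). 0 < f x}"
          using inf below[OF z(1) x] finite_subset by blast
        then obtain g where g: "g \<in> ?I" "g \<notin> V (up z)" by blast
        then obtain y where y: "y \<in> J" "g \<in> N y" by (auto simp: V_def)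
        have "y \<notin> up z" using y g by (auto simp: V_def)
        then have zy: "(z, y) \<in> R" using totR z(1) y(1) J(1) by (auto simp: up_def lo_def)
        then have "up z \<subseteq> lo y" using trR by (auto simp: up_def lo_def)
        then have Elo: "E \<subseteq> (\<Union>y\<in>lo y. N y)" using z(2) unfolding V_def by blast
        obtain l0 where l0: "set l0 = E" using finite_list[OF E(1)] by blast
        define l where "l = map (\<lambda>f. (f, n f)) l0"
        have l: "set l = (\<lambda>f. (f, n f)) ` E" by (simp add: l_def l0)
        have "l \<in> lists ((\<Union>y\<in>lo y. N y) \<times> UNIV)" using Elo l by (auto simp: lists_eq_set)
        then have "wit l \<in> M y" using M_eq[of y] by (auto simp: W_def)
        moreover have "\<exists>x\<in>wit l. \<forall>(f, n)\<in>set l. inverse (real (Suc n)) < f x"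
          using x n E(2) by (intro wit) (auto simp: l)
        ultimately obtain w where w: "w \<in> ?S" "\<forall>(f, n)\<in>set l. inverse (real (Suc n)) < f w"
          using y(1) by blast
        then have "\<forall>f\<in>E. inverse (real (Suc (n f))) \<le> f w" by (auto simp: l intro: less_imp_le)
        with w(1) show "\<exists>x\<in>?S. \<forall>f\<in>E. inverse (real (Suc (n f))) \<le> f x" by blast
      qed
      then obtain w z A where w: "z \<in> J" "A \<in> M z" "w \<in> A" "\<forall>f\<in>?I. 0 < f w" by blast
      have "?I \<subseteq> {f \<in> V (up z). 0 < f x}"
      proof
        fix f assume f: "f \<in> ?I"
        then obtain y where y: "y \<in> J" "f \<in> N y" by (auto simp: V_def)
        have "y \<in> up z"
        proof (rule ccontr)
          assume "y \<notin> up z"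
          then have "z \<in> lo y" using totR w(1) y(1) J(1) by (auto simp: up_def lo_def)
          then have "f w = 0" using Nlo[of y f z A w] y w J(1) by blast
          then show False using w(4) f by force
        qed
        then show "f \<in> {f \<in> V (up z). 0 < f x}" using f y unfolding V_def by blast
      qed
      then show False using inf below[OF w(1) x] finite_subset by blast
    qed
    have pf: "finite {f \<in> V (up z). 0 < f x}" if "z \<in> \<Z>" "x \<in> topspace K" for z x
      using wfR that
    proof (induction z arbitrary: x rule: wf_induct_rule)
      case (less z)
      have "finite {f \<in> V (lo z). 0 < f x}"
        by (rule limit[OF loZ _ _ less.prems(2)])
          (use less.IH loZ trR in \<open>auto simp: lo_def\<close>)
      moreover have "finite {f \<in> N z. 0 < f x}"
        using Ncov[OF less.prems(1)] less.prems(2) by (simp add: cozero_cover_def)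
      moreover have "{f \<in> V (up z). 0 < f x} = {f \<in> N z. 0 < f x} \<union> {f \<in> V (lo z). 0 < f x}"
        by (auto simp: V_def up_def)
      ultimately show ?case by simp
    qed
    have "|V \<Z>| \<le>o |\<Z> <+> (UNIV :: nat set)|"
      unfolding V_def
    proof (rule card_of_UNION_ordLeq_infinite)
      show "\<forall>z\<in>\<Z>. |N z| \<le>o |\<Z> <+> (UNIV :: nat set)|"
      proof
        fix z assume z: "z \<in> \<Z>"
        have "lo z <+> (UNIV :: nat set) \<subseteq> \<Z> <+> UNIV" using loZ by blast
        then show "|N z| \<le>o |\<Z> <+> (UNIV :: nat set)|"
          using size[OF z] card_of_mono1 ordLeq_transitive by blast
      qed
    qed (simp_all add: card_of_Plus1)
    moreover have "cozero_cover K G (\<Union>\<Z>) (V \<Z>)"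
      unfolding cozero_cover_def
    proof (intro conjI ballI)
      fix f assume "f \<in> V \<Z>"
      then obtain z where z: "z \<in> \<Z>" "f \<in> N z" by (auto simp: V_def)
      show "continuous_map K euclideanreal f" using Ncont[OF z] .
      show "0 \<le> f x" if "x \<in> topspace K" for x using Nnonneg[OF z that] .
      show "f x = 0" if "x \<in> G" for x using NG[OF z that] .
    next
      show "finite {f \<in> V \<Z>. 0 < f x}" if "x \<in> topspace K" for x
        using limit[OF order_refl loZ pf that] by simp
    next
      fix x assume x: "x \<in> \<Union>\<Z> - G"
      let ?Q = "{z \<in> \<Z>. x \<in> \<Union>(M z)}"
      obtain z0 where "z0 \<in> \<Z>" "x \<in> z0" using x by blast
      then have z0: "z0 \<in> ?Q" using M_eq[of z0] by blast
      \<comment> \<open>At the first stage that reaches \<open>x\<close>, the point is outside the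
        set on which the new functions must vanish, so one of them is positive there.\<close>
      obtain z where z: "z \<in> ?Q" "\<And>y. (y, z) \<in> R \<Longrightarrow> y \<notin> ?Q" by (rule wfE_min[OF wfR z0]) blast
      then have "x \<in> \<Union>(M z) - (G \<union> \<Union>(\<Union>y\<in>lo z. M y))"
        using x loZ[of z] by (auto simp: lo_def)
      then have "\<exists>f\<in>N z. 0 < f x" using Ncov[of z] z(1) by (simp add: cozero_cover_def)
      then show "\<exists>f\<in>V \<Z>. 0 < f x" using z(1) by (auto simp: V_def)
    qed
    ultimately show ?thesis by blast
  qed
qed

section \<open>Consequences for closure preserving covers\<close>

lemma regular_space_shrink:
  assumes "regular_space K" "openin K W" "x \<in> W"
  obtains U V where "openin K U" "closedin K V" "x \<in> U" "U \<subseteq> V" "V \<subseteq> W"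
  using assms neighbourhood_base_of_closedin[of K] unfolding neighbourhood_base_of by meson

lemma hereditarily_metacompact_cozero:
  assumes K: "compact_space K"
    and cz: "\<And>G. closedin K G \<Longrightarrow> \<exists>F. cozero_cover K G (topspace K) F"
  shows "hereditarily_metacompact_space K"
  unfolding hereditarily_metacompact_space_def metacompact_space_def
proof (intro allI impI)
  fix A \<U> assume A: "A \<subseteq> topspace K" and U: "open_cover_of (subtopology K A) \<U>"
  have topA: "topspace (subtopology K A) = A" using A by auto
  \<comment> \<open>Relatively open sets are traces of open sets of \<open>K\<close>. This moves the
    problem from the arbitrary subspace \<open>A\<close> to the open set
    \<open>\<Union>\<T>\<close>, the complement of a closed set.\<close>
  define \<T> where "\<T> = {T. openin K T \<and> (\<exists>U\<in>\<U>. T \<inter> A \<subseteq> U)}"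
  have AT: "A \<subseteq> \<Union>\<T>"
  proof
    fix x assume "x \<in> A"
    then obtain U' where "x \<in> U'" "U' \<in> \<U>" using U topA unfolding open_cover_of_def by blast
    moreover then obtain T where "openin K T" "U' = T \<inter> A" using U unfolding open_cover_of_def openin_subtopology by blast
    ultimately show "x \<in> \<Union>\<T>" unfolding \<T>_def by blast
  qed
  define G where "G = topspace K - \<Union>\<T>"
  have "openin K (\<Union>\<T>)" unfolding \<T>_def by (intro openin_Union) auto
  then have "closedin K G" unfolding G_def by (simp add: closedin_diff)
  then obtain F where F: "cozero_cover K G (topspace K) F" using cz by blast
  note Fc = cozero_coverD[OF F]
  have Ffin: "finite {f \<in> F. 0 < f x}" if "x \<in> topspace K" for x using F that by (simp add: cozero_cover_def)
  have Fcov: "\<exists>f\<in>F. 0 < f x" if "x \<in> A" for x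
    using F that A AT by (auto simp: cozero_cover_def G_def)
  have "\<exists>\<S>. finite \<S> \<and> \<S> \<subseteq> \<T> \<and> {x \<in> topspace K. inverse (real (Suc (Suc n))) \<le> f x} \<subseteq> \<Union>\<S>" if f: "f \<in> F" for f n
  proof -
    let ?C = "{x \<in> topspace K. inverse (real (Suc (Suc n))) \<le> f x}"
    have "closedin K ?C" using Fc(1)[OF f] by (intro closedin_real_le) auto
    then have "compactin K ?C" using K closedin_compact_space by blast
    moreover have "?C \<subseteq> \<Union>\<T>"
    proof
      fix x assume x: "x \<in> ?C"
      have "0 < inverse (real (Suc (Suc n)))" by simp
      with x have "f x \<noteq> 0" by auto
      then have "x \<notin> G" using Fc(3)[OF f] by blast
      with x show "x \<in> \<Union>\<T>" by (simp add: G_def)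
    qed
    ultimately show ?thesis unfolding compactin_def \<T>_def by (metis (no_types, lifting) mem_Collect_eq)
  qed
  then obtain S where S: "\<And>f n. f \<in> F \<Longrightarrow> finite (S f n) \<and> S f n \<subseteq> \<T> \<and>
      {x \<in> topspace K. inverse (real (Suc (Suc n))) \<le> f x} \<subseteq> \<Union>(S f n)" by metis
  \<comment> \<open>The factor form of \<open>f x < 1/n\<close> is vacuous for \<open>n = 0\<close>,
    so large values belong to a shell too. It also leaves only finitely many shells through a point
    where \<open>f\<close> is positive.\<close>
  define Q where "Q f n = {x \<in> topspace K. inverse (real (Suc (Suc n))) < f x} \<inter>
       {x \<in> topspace K. real n * f x < 1}" for f n
  define \<V> where "\<V> = (\<lambda>(f, n, T). Q f n \<inter> T \<inter> A) ` (SIGMA f:F. SIGMA n:UNIV. S f n)"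
  show "\<exists>\<V>. open_cover_of (subtopology K A) \<V> \<and> refines \<V> \<U> \<and>
       (\<forall>x\<in>topspace (subtopology K A). finite {V \<in> \<V>. x \<in> V})"
  proof (intro exI[of _ \<V>] conjI ballI)
    have "\<exists>V\<in>\<V>. x \<in> V" if x: "x \<in> A" for x
    proof -
      obtain f where f: "f \<in> F" "0 < f x" using Fcov[OF x] by blast
      define n where "n = (LEAST n. inverse (real (Suc (Suc n))) < f x)"
      obtain m where m: "inverse (real (Suc m)) < f x" using f reals_Archimedean by blast
      have "inverse (real (Suc (Suc m))) \<le> inverse (real (Suc m))" by (simp add: field_simps)
      then have "inverse (real (Suc (Suc m))) < f x" using m by linarith
      then have n1: "inverse (real (Suc (Suc n))) < f x" unfolding n_def by (rule LeastI)
      have n2: "real n * f x < 1"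
      proof (cases n)
        case (Suc k)
        then have "k < n" by simp
        then have "\<not> inverse (real (Suc (Suc k))) < f x" unfolding n_def by (rule not_less_Least)
        then have "real (Suc (Suc k)) * f x \<le> 1" by (simp add: field_simps)
        then show ?thesis using f(2) by (simp add: Suc algebra_simps)
      qed simp
      have xQ: "x \<in> Q f n" using n1 n2 x A by (auto simp: Q_def)
      then have "x \<in> {x \<in> topspace K. inverse (real (Suc (Suc n))) \<le> f x}" by (simp add: Q_def)
      then have "x \<in> \<Union>(S f n)" using S[OF f(1), of n] by blast
      then obtain T where "T \<in> S f n" "x \<in> T" by blast
      then have "(f, n, T) \<in> (SIGMA f:F. SIGMA n:UNIV. S f n)" using f(1) by (intro SigmaI UNIV_I)
      then have "Q f n \<inter> T \<inter> A \<in> \<V>" unfolding \<V>_def by (rule rev_image_eqI) simp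
      moreover have "x \<in> Q f n \<inter> T \<inter> A" using xQ x \<open>x \<in> T\<close> by simp
      ultimately show ?thesis by (rule bexI[rotated])
    qed
    moreover have "openin (subtopology K A) V \<and> (\<exists>U\<in>\<U>. V \<subseteq> U)" if V: "V \<in> \<V>" for V
    proof -
      obtain f n T where T: "f \<in> F" "T \<in> S f n" "V = Q f n \<inter> T \<inter> A" using V unfolding \<V>_def by auto
      have "T \<in> \<T>" using S T by blast
      then have "openin K T" "\<exists>U\<in>\<U>. T \<inter> A \<subseteq> U" by (auto simp: \<T>_def)
      moreover have "openin K (Q f n)"
        unfolding Q_def using Fc(1)[OF T(1)] by (intro openin_Int openin_real_less) (auto intro!: continuous_intros)
      ultimately show ?thesis unfolding T(3) by (auto intro: openin_subtopology_Int)
    qed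
    moreover have "V \<subseteq> A" if "V \<in> \<V>" for V using that by (auto simp: \<V>_def)
    ultimately show "open_cover_of (subtopology K A) \<V>" "refines \<V> \<U>"
      unfolding open_cover_of_def refines_def topA by (blast, meson)
    fix x assume "x \<in> topspace (subtopology K A)"
    then have x: "x \<in> topspace K" using A by auto
    have nf: "finite {n. x \<in> Q f n}" if f: "0 < f x" for f
    proof -
      obtain N where "1 / f x < real N" using reals_Archimedean2 by blast
      then have N: "1 < real N * f x" using f by (simp add: field_simps)
      have "n < N" if "x \<in> Q f n" for n
      proof (rule ccontr)
        assume "\<not> n < N"
        then have "real N * f x \<le> real n * f x" using f by (intro mult_right_mono) auto
        then show False using N that by (simp add: Q_def)
      qed
      then show ?thesis by (intro finite_nat_iff_bounded[THEN iffD2] exI[of _ N]) auto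
    qed
    have "{V \<in> \<V>. x \<in> V} \<subseteq> (\<lambda>(f, n, T). Q f n \<inter> T \<inter> A) `
        (SIGMA f:{f \<in> F. 0 < f x}. SIGMA n:{n. x \<in> Q f n}. S f n)"
    proof
      fix V assume V: "V \<in> {V \<in> \<V>. x \<in> V}"
      then obtain f n T where T: "f \<in> F" "T \<in> S f n" "V = Q f n \<inter> T \<inter> A" unfolding \<V>_def by auto
      have xQ: "x \<in> Q f n" using V T by auto
      have "0 < inverse (real (Suc (Suc n)))" by simp
      also have "\<dots> < f x" using xQ by (simp add: Q_def)
      finally have "0 < f x" .
      then have "(f, n, T) \<in> (SIGMA f:{f \<in> F. 0 < f x}. SIGMA n:{n. x \<in> Q f n}. S f n)" using T xQ by simp
      then show "V \<in> (\<lambda>(f, n, T). Q f n \<inter> T \<inter> A) `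
        (SIGMA f:{f \<in> F. 0 < f x}. SIGMA n:{n. x \<in> Q f n}. S f n)" unfolding T(3)
        by (rule rev_image_eqI) simp
    qed
    moreover have "finite (SIGMA f:{f \<in> F. 0 < f x}. SIGMA n:{n. x \<in> Q f n}. S f n)"
      using Ffin[OF x] nf S by (intro finite_SigmaI) auto
    ultimately show "finite {V \<in> \<V>. x \<in> V}" using finite_surj by blast
  qed
qed

text \<open>The points chosen along a nested sequence of open sets lie in the union of the members that
  were avoided one after the other; this union is closed, so it contains an accumulation point of the
  sequence, which by construction is in none of these members.\<close>
lemma relatively_open_subset_of_member:
  assumes K: "compact_space K" "Hausdorff_space K"
    and clo: "\<And>\<B>. \<B> \<subseteq> \<A> \<Longrightarrow> closedin K (\<Union>\<B>)"
    and cov: "\<Union>\<A> = topspace K" and C: "C \<subseteq> topspace K" "C \<noteq> {}"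
  shows "\<exists>U A. openin K U \<and> A \<in> \<A> \<and> U \<inter> C \<noteq> {} \<and> U \<inter> C \<subseteq> A"
proof (rule ccontr)
  assume no: "\<not> ?thesis"
  have reg: "regular_space K" using K compact_Hausdorff_imp_regular_space by blast
  define P where "P p \<longleftrightarrow> openin K (fst p) \<and> snd p \<in> fst p \<inter> C" for p :: "'a set \<times> 'a"
  \<comment> \<open>The closed set \<open>V\<close> between the next open set and
    \<open>fst p - A\<close> keeps accumulation points of the later points, and not only these
    points, out of \<open>A\<close>.\<close>
  define Q where "Q p q \<longleftrightarrow> (\<exists>A\<in>\<A>. \<exists>V. snd p \<in> A \<and> closedin K V \<and> fst q \<subseteq> V \<and> V \<subseteq> fst p - A)"
    for p q :: "'a set \<times> 'a"
  have "\<exists>s. \<forall>n. P (s n) \<and> Q (s n) (s (Suc n))"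
  proof (rule dependent_nat_choice)
    obtain c where "c \<in> C" using C by blast
    then have "P (topspace K, c)" using C by (auto simp: P_def)
    then show "\<exists>p. P p" by blast
  next
    fix p assume "P p"
    then have p: "openin K (fst p)" "snd p \<in> fst p" "snd p \<in> C" by (auto simp: P_def)
    then obtain A where A: "A \<in> \<A>" "snd p \<in> A" using cov C by blast
    have "\<not> fst p \<inter> C \<subseteq> A" using no p A by blast
    then obtain y where y: "y \<in> fst p - A" "y \<in> C" by blast
    have "closedin K A" using clo[of "{A}"] A by simp
    then have "openin K (fst p - A)" using p by (simp add: openin_diff)
    then obtain U V where UV: "openin K U" "closedin K V" "y \<in> U" "U \<subseteq> V" "V \<subseteq> fst p - A"
      using regular_space_shrink[OF reg _ y(1)] by blast
    then have "P (U, y)" "Q p (U, y)" using A y unfolding P_def Q_def by auto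
    then show "\<exists>q. P q \<and> Q p q" by blast
  qed
  then obtain s where s: "\<And>n. P (s n)" "\<And>n. Q (s n) (s (Suc n))" by blast
  then have "\<exists>A V. A \<in> \<A> \<and> snd (s n) \<in> A \<and> closedin K V \<and> fst (s (Suc n)) \<subseteq> V \<and> V \<subseteq> fst (s n) - A" for n
    using s(2)[of n] unfolding Q_def by (elim bexE exE) (intro exI conjI; assumption | elim conjE)+
  then obtain A V where A: "\<And>n. A n \<in> \<A>" "\<And>n. snd (s n) \<in> A n" and V: "\<And>n. closedin K (V n)"
    "\<And>n. fst (s (Suc n)) \<subseteq> V n" "\<And>n. V n \<subseteq> fst (s n) - A n" by metis
  have dec: "decseq (\<lambda>n. fst (s n))" using V by (intro decseq_SucI) blast
  define T where "T n = K closure_of ((\<lambda>m. snd (s m)) ` {n..})" for n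
  have "(\<Inter>n. T n) \<noteq> {}"
  proof (rule compact_space_imp_nest[OF K(1)])
    show "closedin K (T n)" for n by (simp add: T_def)
    show "T n \<noteq> {}" for n
    proof -
      have "snd (s n) \<in> T n"
        unfolding T_def using s(1)[of n] C by (intro subsetD[OF closure_of_subset_Int]) (auto simp: P_def)
      then show ?thesis by blast
    qed
    show "decseq T" by (rule decseq_SucI) (auto simp: T_def intro!: closure_of_mono)
  qed
  then obtain w where w: "\<And>n. w \<in> T n" by blast
  have "closedin K (\<Union>(range A))" using A(1) by (intro clo) blast
  then have "T 0 \<subseteq> \<Union>(range A)" unfolding T_def using A(2) by (intro closure_of_minimal) auto
  then obtain n where n: "w \<in> A n" using w by blast
  have "T (Suc n) \<subseteq> V n"
    unfolding T_def
  proof (rule closure_of_minimal[OF _ V(1)])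
    show "(\<lambda>m. snd (s m)) ` {Suc n..} \<subseteq> V n"
    proof
      fix x assume "x \<in> (\<lambda>m. snd (s m)) ` {Suc n..}"
      then obtain m where m: "Suc n \<le> m" "x = snd (s m)" by auto
      then have "x \<in> fst (s m)" using s(1)[of m] by (simp add: P_def)
      also have "fst (s m) \<subseteq> fst (s (Suc n))" using decseqD[OF dec m(1)] .
      finally show "x \<in> V n" using V(2) by blast
    qed
  qed
  then show False using w[of "Suc n"] n V(3)[of n] by blast
qed

section \<open>Finite dimensional compacta\<close>

text \<open>Transfinite shrinking. Normality of the union is not available, but the part of a member
  that is still to be covered is closed in its closure, hence compact.\<close>
lemma point_finite_cozero_shrinking:
  assumes K: "compact_space K" "Hausdorff_space K"
    and op: "\<And>V. V \<in> \<V> \<Longrightarrow> openin K V" and cl: "\<And>V. V \<in> \<V> \<Longrightarrow> K closure_of V \<subseteq> \<Union>\<V>"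
    and pf: "\<And>x. x \<in> \<Union>\<V> \<Longrightarrow> finite {V \<in> \<V>. x \<in> V}"
  shows "\<exists>k. (\<forall>V\<in>\<V>. continuous_map K euclideanreal (k V) \<and>
           (\<forall>x\<in>topspace K. 0 \<le> k V x) \<and> (\<forall>x\<in>topspace K - V. k V x = (0::real))) \<and>
         (\<forall>x\<in>\<Union>\<V>. \<exists>V\<in>\<V>. 0 < k V x)"
proof -
  define R where "R = |\<V>| - Id"
  have wo: "well_order_on \<V> |\<V>|" by (rule card_of_well_order_on)
  then have wfR: "wf R" by (simp add: R_def well_order_on_def)
  have trR: "(x, z) \<in> R" if "(x, y) \<in> R" "(y, z) \<in> R" for x y z
  proof -
    have "trans |\<V>|" "antisym |\<V>|"
      using wo unfolding well_order_on_def linear_order_on_def partial_order_on_def preorder_on_def by auto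
    with that show ?thesis unfolding R_def by (auto dest: transD antisymD)
  qed
  have totR: "(x, y) \<in> R \<or> (y, x) \<in> R \<or> x = y" if "x \<in> \<V>" "y \<in> \<V>" for x y
    using wo that unfolding well_order_on_def linear_order_on_def total_on_def R_def by auto
  have RV: "x \<in> \<V>" "y \<in> \<V>" if "(x, y) \<in> R" for x y
    using that Field_card_of[of \<V>] by (auto simp: R_def Field_def)
  have irr: "(x, x) \<notin> R" for x by (simp add: R_def)
  \<comment> \<open>Point-finiteness gives every point of the union a last member through it; that
    stage is its final chance to be covered.\<close>
  have last: "\<exists>V\<in>S. \<forall>U. (V, U) \<in> R \<longrightarrow> U \<notin> S" if S: "finite S" "S \<noteq> {}" for S
  proof -
    have "transp_on S (\<lambda>x y. (x, y) \<in> R)" using trR by (auto simp: transp_on_def)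
    moreover have "asymp_on S (\<lambda>x y. (x, y) \<in> R)" using trR irr by (auto simp: asymp_on_def)
    ultimately have "\<exists>V\<in>S. \<forall>x\<in>S. x \<noteq> V \<longrightarrow> (V, x) \<notin> R"
      using S by (intro Finite_Set.bex_max_element)
    then obtain V where V: "V \<in> S" "\<And>x. x \<in> S \<Longrightarrow> x \<noteq> V \<Longrightarrow> (V, x) \<notin> R" by blast
    have "U \<notin> S" if "(V, U) \<in> R" for U using V(2)[of U] irr[of V] that by metis
    then show ?thesis using V(1) by blast
  qed
  define rest where "rest f V = \<Union>\<V> - \<Union>{U \<in> \<V>. (V, U) \<in> R} - {x. \<exists>U. (U, V) \<in> R \<and> 0 < f U x}"
    for f :: "'a set \<Rightarrow> 'a \<Rightarrow> real" and V
  define P where "P f V k \<longleftrightarrow> (V \<in> \<V> \<longrightarrow> continuous_map K euclideanreal k \<and>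
     (\<forall>x\<in>topspace K. 0 \<le> k x) \<and> (\<forall>x\<in>topspace K - V. k x = 0) \<and> (\<forall>x\<in>rest f V. 0 < k x))"
    for f and V and k :: "'a \<Rightarrow> real"
  have "\<exists>f. \<forall>V. P f V (f V)"
  proof (rule dependent_wf_choice[OF wfR])
    fix f g :: "'a set \<Rightarrow> 'a \<Rightarrow> real" and V k
    assume "\<And>U. (U, V) \<in> R \<Longrightarrow> f U = g U"
    then have "rest f V = rest g V" unfolding rest_def by auto
    then show "P f V k = P g V k" by (simp add: P_def)
  next
    fix V and f :: "'a set \<Rightarrow> 'a \<Rightarrow> real"
    assume IH: "\<And>U. (U, V) \<in> R \<Longrightarrow> P f U (f U)"
    show "\<exists>k. P f V k"
    proof (cases "V \<in> \<V>")
      case V: True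
      \<comment> \<open>Let \<open>U\<close> be the last member through \<open>x\<close>. If
        \<open>x\<close> were not in \<open>V\<close>, then \<open>U\<close> would precede
        \<open>V\<close>, and \<open>x\<close> would have been covered at stage \<open>U\<close> or
        earlier, so nothing would be due for it at stage \<open>V\<close>.\<close>
      have sub: "rest f V \<subseteq> V"
      proof
        fix x assume x: "x \<in> rest f V"
        show "x \<in> V"
        proof (rule ccontr)
          assume "x \<notin> V"
          have "finite {U \<in> \<V>. x \<in> U}" "{U \<in> \<V>. x \<in> U} \<noteq> {}"
            using x pf by (auto simp: rest_def)
          then obtain U where U: "U \<in> \<V>" "x \<in> U" "\<And>U'. (U, U') \<in> R \<Longrightarrow> U' \<in> \<V> \<Longrightarrow> x \<notin> U'"
            using last[of "{U \<in> \<V>. x \<in> U}"] by auto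
          have UV: "(U, V) \<in> R" using totR[OF U(1) V] U \<open>x \<notin> V\<close> x V by (auto simp: rest_def)
          have "x \<notin> rest f U"
          proof
            assume "x \<in> rest f U"
            then have "0 < f U x" using IH[OF UV] U(1) by (simp add: P_def)
            then show False using x UV by (auto simp: rest_def)
          qed
          then obtain U' where "(U', U) \<in> R" "0 < f U' x" using U by (auto simp: rest_def)
          then show False using x trR[OF _ UV] by (auto simp: rest_def)
        qed
      qed
      have "closedin K (rest f V)"
      proof -
        have eq: "rest f V = (K closure_of V - \<Union>{U \<in> \<V>. (V, U) \<in> R}) -
           \<Union>((\<lambda>U. {x \<in> topspace K. 0 < f U x}) ` {U. (U, V) \<in> R})" (is "_ = ?A")
        proof
          have "V \<subseteq> K closure_of V" using op[OF V] openin_subset closure_of_subset by metis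
          then show "rest f V \<subseteq> ?A" using sub by (auto simp: rest_def)
          have "K closure_of V \<subseteq> topspace K" by (rule closure_of_subset_topspace)
          then show "?A \<subseteq> rest f V" using cl[OF V] by (auto simp: rest_def)
        qed
        have "continuous_map K euclideanreal (f U)" if "(U, V) \<in> R" for U
          using IH[OF that] RV(1)[OF that] by (simp add: P_def)
        then show ?thesis unfolding eq using op
          by (intro closedin_diff openin_Union closedin_closure_of) (auto intro!: openin_real_less)
      qed
      moreover have "closedin K (topspace K - V)" using op[OF V] by blast
      moreover have "(topspace K - V) \<inter> rest f V = {}" using sub by blast
      ultimately obtain k where k: "continuous_map K euclideanreal k"
        "\<And>x. x \<in> topspace K \<Longrightarrow> 0 \<le> k x \<and> k x \<le> (1::real)"
        "\<And>x. x \<in> topspace K - V \<Longrightarrow> k x = 0" "\<And>x. x \<in> rest f V \<Longrightarrow> k x = 1"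
        using Urysohn_zero_one[OF K, of "topspace K - V" "rest f V"] by metis
      then have "P f V k" by (simp add: P_def)
      then show ?thesis by blast
    qed (simp add: P_def)
  qed
  then obtain k where k: "\<And>V. P k V (k V)" by blast
  have "\<exists>V\<in>\<V>. 0 < k V x" if x: "x \<in> \<Union>\<V>" for x
  proof -
    have "finite {U \<in> \<V>. x \<in> U}" "{U \<in> \<V>. x \<in> U} \<noteq> {}" using x pf by auto
    then obtain U where U: "U \<in> \<V>" "x \<in> U" "\<And>U'. (U, U') \<in> R \<Longrightarrow> U' \<in> \<V> \<Longrightarrow> x \<notin> U'"
      using last[of "{U \<in> \<V>. x \<in> U}"] by auto
    show ?thesis
    proof (cases "x \<in> rest k U")
      case True
      then show ?thesis using k[of U] U(1) by (auto simp: P_def)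
    next
      case False
      then obtain U' where "(U', U) \<in> R" "0 < k U' x" using U by (auto simp: rest_def)
      then show ?thesis using RV(1) by blast
    qed
  qed
  moreover have "\<forall>V\<in>\<V>. continuous_map K euclideanreal (k V) \<and>
           (\<forall>x\<in>topspace K. 0 \<le> k V x) \<and> (\<forall>x\<in>topspace K - V. k V x = 0)"
    using k by (simp add: P_def)
  ultimately show ?thesis by blast
qed

section \<open>Perturbing functions until they separate points\<close>

text \<open>This is all the general position that is used: intervals are infinite, so finitely many
  values become distinct after small moves.\<close>

lemma finite_inj_on_near:
  fixes f :: "'b \<Rightarrow> real"
  assumes "finite A" "0 < e"
  shows "\<exists>c. inj_on c A \<and> (\<forall>a\<in>A. \<bar>c a - f a\<bar> < e)"
  using assms(1)
proof (induction A rule: finite_induct)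
  case (insert a A)
  then obtain c where c: "inj_on c A" "\<forall>a\<in>A. \<bar>c a - f a\<bar> < e" by blast
  have "infinite {f a <..< f a + e}" using assms(2) by simp
  then have "infinite ({f a <..< f a + e} - c ` A)" using insert by (simp add: Diff_infinite_finite)
  then have "{f a <..< f a + e} - c ` A \<noteq> {}" by (rule infinite_imp_nonempty)
  then obtain v where "v \<in> {f a <..< f a + e} - c ` A" by blast
  then have v: "f a < v" "v < f a + e" "v \<notin> c ` A" by simp_all
  have "inj_on (c(a := v)) (insert a A)"
    using c(1) v(3) insert.hyps(2) by (auto simp: inj_on_def)
  moreover have "\<forall>b\<in>insert a A. \<bar>(c(a := v)) b - f b\<bar> < e" using c(2) v by auto
  ultimately show ?case by blast
qed simp

lemma finite_open_cover_small_oscillation: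
  fixes g :: "nat \<Rightarrow> 'a \<Rightarrow> real"
  assumes X: "compact_space X" and U: "open_cover_of X \<U>"
    and g: "\<And>i. i < N \<Longrightarrow> continuous_map X euclideanreal (g i)" and e: "0 < e"
  shows "\<exists>\<W>. finite \<W> \<and> open_cover_of X \<W> \<and> refines \<W> \<U> \<and>
     (\<forall>W\<in>\<W>. \<forall>x\<in>W. \<forall>y\<in>W. \<forall>i<N. \<bar>g i x - g i y\<bar> < e)"
proof -
  define \<T> where "\<T> = {W. openin X W \<and> (\<exists>U\<in>\<U>. W \<subseteq> U) \<and> (\<forall>x\<in>W. \<forall>y\<in>W. \<forall>i<N. \<bar>g i x - g i y\<bar> < e)}"
  have "topspace X \<subseteq> \<Union>\<T>"
  proof
    fix x assume x: "x \<in> topspace X"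
    then obtain U' where U': "U' \<in> \<U>" "x \<in> U'" "openin X U'" using U by (auto simp: open_cover_of_def)
    let ?W = "U' \<inter> {y \<in> topspace X. \<forall>i\<in>{..<N}. \<bar>g i y - g i x\<bar> < e/2}"
    have "openin X ?W" using U'(3) g by (intro openin_Int openin_coordinate_box) auto
    moreover have "\<bar>g i y - g i z\<bar> < e" if "y \<in> ?W" "z \<in> ?W" "i < N" for y z i
    proof -
      have "\<bar>g i y - g i x\<bar> < e/2" "\<bar>g i z - g i x\<bar> < e/2" using that by auto
      then show ?thesis by linarith
    qed
    ultimately have "?W \<in> \<T>" using U'(1) unfolding \<T>_def by blast
    moreover have "x \<in> ?W" using x U' e by auto
    ultimately show "x \<in> \<Union>\<T>" by blast
  qed
  moreover have "\<And>W. W \<in> \<T> \<Longrightarrow> openin X W" by (simp add: \<T>_def)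
  ultimately obtain \<W> where W: "finite \<W>" "\<W> \<subseteq> \<T>" "topspace X \<subseteq> \<Union>\<W>"
    using X unfolding compact_space_alt by meson
  have T: "openin X W" "\<exists>U\<in>\<U>. W \<subseteq> U" "\<forall>x\<in>W. \<forall>y\<in>W. \<forall>i<N. \<bar>g i x - g i y\<bar> < e" if "W \<in> \<W>" for W
    using that W(2) by (auto simp: \<T>_def)
  then have "\<Union>\<W> \<subseteq> topspace X" using openin_subset by (meson Union_least)
  then have "open_cover_of X \<W>" using W(3) T(1) by (simp add: open_cover_of_def)
  moreover have "refines \<W> \<U>" using T(2) by (simp add: refines_def)
  ultimately show ?thesis using W(1) T(3) by (intro exI[of _ \<W>]) simp
qed

lemma finite_positive_lower_bound:
  fixes S :: "real set"
  assumes "finite S" "\<And>s. s \<in> S \<Longrightarrow> 0 < s"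
  shows "\<exists>c>0. \<forall>s\<in>S. c \<le> s"
proof (intro exI[of _ "Min (insert 1 S)"] conjI ballI)
  show "0 < Min (insert 1 S)" using assms by simp
  show "Min (insert 1 S) \<le> s" if "s \<in> S" for s using assms(1) that by (intro Min_le) auto
qed

lemma cover_functions_lower_bound:
  fixes k :: "'b \<Rightarrow> 'a \<Rightarrow> real"
  assumes X: "compact_space X" and k: "\<And>V. V \<in> \<V> \<Longrightarrow> continuous_map X euclideanreal (k V)"
    and ne: "\<V> \<noteq> {}"
    and pos: "\<And>x. x \<in> topspace X \<Longrightarrow> \<exists>V\<in>\<V>. 0 < k V x"
  shows "\<exists>c>0. \<forall>x\<in>topspace X. \<exists>V\<in>\<V>. c < k V x"
proof -
  define C where "C n = (\<Inter>V\<in>\<V>. {x \<in> topspace X. k V x \<le> inverse (real (Suc n))})" for n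
  have "\<exists>n. C n = {}"
  proof (rule ccontr)
    assume no: "\<not> (\<exists>n. C n = {})"
    have "(\<Inter>n. C n) \<noteq> {}"
    proof (rule compact_space_imp_nest[OF X])
      show "closedin X (C n)" for n
        unfolding C_def using k ne by (intro closedin_INT closedin_real_le) auto
      show "C n \<noteq> {}" for n using no by blast
      show "decseq C"
      proof (rule decseq_SucI)
        fix n
        have "inverse (real (Suc (Suc n))) \<le> inverse (real (Suc n))" by (simp add: field_simps)
        then have "t \<le> inverse (real (Suc n))" if "t \<le> inverse (real (Suc (Suc n)))" for t
          using that by linarith
        then show "C (Suc n) \<subseteq> C n" unfolding C_def by blast
      qed
    qed
    then obtain x where x: "\<And>n. x \<in> C n" by blast
    have "x \<in> topspace X" using x[of 0] ne by (auto simp: C_def)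
    then obtain V where V: "V \<in> \<V>" "0 < k V x" using pos by blast
    then obtain n where "inverse (real (Suc n)) < k V x" using reals_Archimedean by blast
    moreover have "k V x \<le> inverse (real (Suc n))" using x[of n] V(1) by (auto simp: C_def)
    ultimately show False by linarith
  qed
  then obtain n where n: "C n = {}" by blast
  have "\<exists>V\<in>\<V>. inverse (real (Suc n)) < k V x" if "x \<in> topspace X" for x
  proof (rule ccontr)
    assume "\<not> ?thesis"
    then have "x \<in> C n" using that by (auto simp: C_def not_less)
    then show False using n by blast
  qed
  then show ?thesis by (intro exI[of _ "inverse (real (Suc n))"]) simp
qed

text \<open>Nearness measured by a cover. A sequence of covers takes the place of a metric:
  functions only have to tell apart points that are not near for one of the covers.\<close>

definition common_member :: "'a set set \<Rightarrow> 'a \<Rightarrow> 'a \<Rightarrow> bool" where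
  "common_member \<U> x y \<longleftrightarrow> (\<exists>U\<in>\<U>. x \<in> U \<and> y \<in> U)"

text \<open>At a point at most \<^term>\<open>m\<close> of the functions \<open>k V\<close> are nonzero, so at most \<^term>\<open>m\<close> of the
  \<open>2 * m + 1\<close> thresholds are close to one of their values. Hence two points always share a threshold
  \<open>i\<close> that is good for both. On the points good for \<open>i\<close>, the set of those \<open>V\<close> with \<open>k V\<close> above the
  threshold is locally constant, and the \<open>i\<close>-th function is moved to distinct constants on the
  pieces.\<close>
lemma perturbation_step:
  fixes g :: "nat \<Rightarrow> 'a \<Rightarrow> real"
  assumes X: "compact_space X" "Hausdorff_space X"
    and dim: "\<And>\<U>. finite \<U> \<Longrightarrow> open_cover_of X \<U> \<Longrightarrow> \<exists>\<V>. finite \<V> \<and> open_cover_of X \<V> \<and>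
        refines \<V> \<U> \<and> (\<forall>x\<in>topspace X. card {V \<in> \<V>. x \<in> V} \<le> m)"
    and N: "N = 2 * m + 1"
    and g: "\<And>i. i < N \<Longrightarrow> continuous_map X euclideanreal (g i)" and \<eta>: "0 < \<eta>"
    and U: "open_cover_of X \<U>"
  shows "\<exists>g' \<gamma>. 0 < \<gamma> \<and> (\<forall>i<N. continuous_map X euclideanreal (g' i)) \<and>
      (\<forall>i<N. \<forall>x\<in>topspace X. \<bar>g' i x - g i x\<bar> \<le> \<eta>) \<and>
      (\<forall>x\<in>topspace X. \<forall>y\<in>topspace X. \<not> common_member \<U> x y \<longrightarrow> (\<exists>i<N. \<gamma> \<le> \<bar>g' i x - g' i y\<bar>))"
proof (cases "topspace X = {}")
  case True
  show ?thesis using g True by (intro exI[of _ g] exI[of _ 1]) auto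
next
  case ne: False
  have "\<exists>\<W>. finite \<W> \<and> open_cover_of X \<W> \<and> refines \<W> \<U> \<and>
     (\<forall>W\<in>\<W>. \<forall>x\<in>W. \<forall>y\<in>W. \<forall>i<N. \<bar>g i x - g i y\<bar> < \<eta>/2)"
    by (rule finite_open_cover_small_oscillation[OF X(1) U g]) (use \<eta> in auto)
  then obtain \<W> where W: "finite \<W>" "open_cover_of X \<W>" "refines \<W> \<U>"
    and W_osc: "\<forall>W\<in>\<W>. \<forall>x\<in>W. \<forall>y\<in>W. \<forall>i<N. \<bar>g i x - g i y\<bar> < \<eta>/2"
    by (elim exE conjE)
  obtain \<V> where V: "finite \<V>" "open_cover_of X \<V>" "refines \<V> \<W>"
    and ord: "\<And>x. x \<in> topspace X \<Longrightarrow> card {V \<in> \<V>. x \<in> V} \<le> m"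
    using dim[OF W(1,2)] by blast
  have VU: "\<Union>\<V> = topspace X" and Vo: "\<And>V. V \<in> \<V> \<Longrightarrow> openin X V"
    using V(2) by (auto simp: open_cover_of_def)
  have osc: "\<bar>g i x - g i y\<bar> < \<eta>/2" and common: "common_member \<U> x y"
    if Vxy: "V \<in> \<V>" "x \<in> V" "y \<in> V" "i < N" for V x y i
  proof -
    obtain W where W': "W \<in> \<W>" "V \<subseteq> W" using V(3) Vxy(1) by (auto simp: refines_def)
    then show "\<bar>g i x - g i y\<bar> < \<eta>/2" 
      using bspec[OF bspec[OF bspec[OF W_osc W'(1)], of x], of y] that by auto
    obtain U where "U \<in> \<U>" "W \<subseteq> U" using W(3) W'(1) by (auto simp: refines_def)
    then show "common_member \<U> x y" using W' that unfolding common_member_def by blast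
  qed
  obtain k where k: "\<And>V. V \<in> \<V> \<Longrightarrow> continuous_map X euclideanreal (k V)"
    "\<And>V x. V \<in> \<V> \<Longrightarrow> x \<in> topspace X - V \<Longrightarrow> k V x = (0::real)"
    "\<And>x. x \<in> topspace X \<Longrightarrow> \<exists>V\<in>\<V>. 0 < k V x"
  proof -
    have "\<exists>k. (\<forall>V\<in>\<V>. continuous_map X euclideanreal (k V) \<and>
           (\<forall>x\<in>topspace X. 0 \<le> k V x) \<and> (\<forall>x\<in>topspace X - V. k V x = (0::real))) \<and>
         (\<forall>x\<in>\<Union>\<V>. \<exists>V\<in>\<V>. 0 < k V x)"
      using V(1) Vo VU closure_of_subset_topspace[of X]
      by (intro point_finite_cozero_shrinking[OF X]) auto
    then show thesis using that VU by metis
  qed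
  have "\<V> \<noteq> {}" using ne VU by (metis Union_empty)
  then obtain c where c: "0 < c" "\<And>x. x \<in> topspace X \<Longrightarrow> \<exists>V\<in>\<V>. c < k V x"
    using cover_functions_lower_bound[of X \<V> k] X(1) k by metis
  \<comment> \<open>The thresholds \<open>\<theta> i = 4 * \<delta> * (i + 1)\<close> with
    \<open>i < N\<close> all stay below \<open>c = 4 * \<delta> * (N + 1)\<close>. Their spacing
    \<open>4 * \<delta>\<close> makes the windows of radius \<open>\<delta>\<close> around them
    disjoint.\<close>
  define \<delta> where "\<delta> = c / (4 * (real N + 1))"
  have \<delta>: "0 < \<delta>" using c by (simp add: \<delta>_def)
  have c\<delta>: "c = 4 * \<delta> * (real N + 1)" by (simp add: \<delta>_def divide_simps) (simp add: algebra_simps)?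
  define \<theta> where "\<theta> i = 4 * \<delta> * (real i + 1)" for i :: nat
  have \<theta>_bounds: "0 < \<theta> i - \<delta>" "\<theta> i + \<delta> < c" if "i < N" for i
  proof -
    have eq: "\<theta> i = 4 * \<delta> + 4 * (\<delta> * real i)" "c = 4 * \<delta> + 4 * (\<delta> * real N)"
      unfolding \<theta>_def c\<delta> by (simp_all add: algebra_simps)
    have "0 \<le> \<delta> * real i" using \<delta> by simp
    then show "0 < \<theta> i - \<delta>" using \<delta> unfolding eq by linarith
    have "\<delta> * (real i + 1) \<le> \<delta> * real N" using that \<delta> by (intro mult_left_mono) auto
    then have "\<delta> * real i + \<delta> \<le> \<delta> * real N" by (simp add: algebra_simps)
    then show "\<theta> i + \<delta> < c" using \<delta> unfolding eq by linarith
  qed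
  have \<theta>_sep: "\<theta> i + 4 * \<delta> \<le> \<theta> j" if "i < j" for i j
  proof -
    have "4 * \<delta> * (real i + 1 + 1) \<le> 4 * \<delta> * (real j + 1)" using that \<delta> by (intro mult_left_mono) auto
    then show ?thesis by (simp add: \<theta>_def algebra_simps)
  qed
  define ok where "ok i x \<longleftrightarrow> (\<forall>V\<in>\<V>. k V x \<le> \<theta> i - \<delta> \<or> \<theta> i + \<delta> \<le> k V x)" for i x
  \<comment> \<open>The pattern of \<open>x\<close> at threshold \<open>i\<close>. It is never
    empty, because some \<open>k V x\<close> exceeds \<open>c\<close>, and its members contain
    \<open>x\<close>, because \<open>k V\<close> vanishes off \<open>V\<close>. Hence points with
    equal patterns share a member of \<open>\<V>\<close>.\<close>
  define S where "S i x = {V \<in> \<V>. \<theta> i + \<delta> \<le> k V x}" for i x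
  have S_ne: "\<exists>V\<in>S i x. x \<in> V" and S_in: "\<And>V. V \<in> S i x \<Longrightarrow> V \<in> \<V> \<and> x \<in> V"
    if "x \<in> topspace X" "i < N" for i x
  proof -
    show *: "V \<in> \<V> \<and> x \<in> V" if "V \<in> S i x" for V
    proof -
      have "V \<in> \<V>" "0 < k V x" using that \<theta>_bounds[OF \<open>i < N\<close>] \<delta> by (auto simp: S_def)
      then show ?thesis using k(2)[of V x] \<open>x \<in> topspace X\<close> by force
    qed
    obtain V where "V \<in> \<V>" "c < k V x" using c(2) \<open>x \<in> topspace X\<close> by blast
    then have "V \<in> S i x" using \<theta>_bounds[OF \<open>i < N\<close>] by (auto simp: S_def)
    then show "\<exists>V\<in>S i x. x \<in> V" using * by blast
  qed
  have bad: "card {i. i < N \<and> \<not> ok i x} \<le> m" if x: "x \<in> topspace X" for x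
  proof -
    have "\<exists>V. V \<in> \<V> \<and> \<theta> i - \<delta> < k V x \<and> k V x < \<theta> i + \<delta>" if "\<not> ok i x" for i
      using that by (auto simp: ok_def not_le)
    then obtain v where v: "\<And>i. \<not> ok i x \<Longrightarrow> v i \<in> \<V> \<and> \<theta> i - \<delta> < k (v i) x \<and> k (v i) x < \<theta> i + \<delta>"
      by metis
    have "inj_on v {i. i < N \<and> \<not> ok i x}"
    proof (rule inj_onI)
      fix i j assume ij: "i \<in> {i. i < N \<and> \<not> ok i x}" "j \<in> {i. i < N \<and> \<not> ok i x}" "v i = v j"
      then have "\<theta> i - \<delta> < k (v i) x" "k (v i) x < \<theta> i + \<delta>" "\<theta> j - \<delta> < k (v i) x" "k (v i) x < \<theta> j + \<delta>"
        using v[of i] v[of j] by auto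
      then show "i = j" using \<theta>_sep[of i j] \<theta>_sep[of j i] \<delta> by (cases i j rule: linorder_cases) auto
    qed
    moreover have "v ` {i. i < N \<and> \<not> ok i x} \<subseteq> {V \<in> \<V>. x \<in> V}"
    proof
      fix V assume "V \<in> v ` {i. i < N \<and> \<not> ok i x}"
      then obtain i where i: "i < N" "\<not> ok i x" "V = v i" by blast
      then have "V \<in> \<V>" "0 < k V x" using v[OF i(2)] \<theta>_bounds[OF i(1)] by auto
      then show "V \<in> {V \<in> \<V>. x \<in> V}" using k(2)[of V x] x by force
    qed
    moreover have "finite {V \<in> \<V>. x \<in> V}" using V(1) by simp
    ultimately show ?thesis using ord[OF x] card_inj_on_le order_trans by meson
  qed
  have good: "\<exists>i<N. ok i x \<and> ok i y" if "x \<in> topspace X" "y \<in> topspace X" for x y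
  proof (rule ccontr)
    assume "\<not> ?thesis"
    then have "{..<N} \<subseteq> {i. i < N \<and> \<not> ok i x} \<union> {i. i < N \<and> \<not> ok i y}" by auto
    then have "card {..<N} \<le> card ({i. i < N \<and> \<not> ok i x} \<union> {i. i < N \<and> \<not> ok i y})"
      by (intro card_mono) auto
    also have "\<dots> \<le> card {i. i < N \<and> \<not> ok i x} + card {i. i < N \<and> \<not> ok i y}" by (rule card_Un_le)
    also have "\<dots> \<le> m + m" using bad that by (intro add_mono) auto
    finally show False using N by simp
  qed
  define Ok where "Ok i = {x \<in> topspace X. ok i x}" for i
  have Ok_closed: "closedin X (Ok i)" for i
  proof -
    have "openin X {x \<in> topspace X. \<theta> i - \<delta> < k V x \<and> k V x < \<theta> i + \<delta>}" if "V \<in> \<V>" for V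
    proof -
      have "{x \<in> topspace X. \<theta> i - \<delta> < k V x \<and> k V x < \<theta> i + \<delta>} =
        {x \<in> topspace X. \<theta> i - \<delta> < k V x} \<inter> {x \<in> topspace X. k V x < \<theta> i + \<delta>}" by auto
      then show ?thesis using k(1)[OF that] by (auto intro!: openin_Int openin_real_less)
    qed
    then have "openin X (\<Union>V\<in>\<V>. {x \<in> topspace X. \<theta> i - \<delta> < k V x \<and> k V x < \<theta> i + \<delta>})" by blast
    moreover have "Ok i = topspace X - (\<Union>V\<in>\<V>. {x \<in> topspace X. \<theta> i - \<delta> < k V x \<and> k V x < \<theta> i + \<delta>})"
      by (auto simp: Ok_def ok_def not_le not_less)
    ultimately show ?thesis by (simp add: closedin_diff)
  qed
  \<comment> \<open>A sample point for each pattern. The constant for \<open>T\<close> is chosen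
    within \<open>\<eta>/2\<close> of \<open>g i\<close> at the sample, and \<open>g i\<close>
    varies by less than \<open>\<eta>/2\<close> on a member shared by the sample and any other point
    with this pattern.\<close>
  define p where "p i T = (SOME x. x \<in> Ok i \<and> S i x = T)" for i T
  have p: "p i (S i x) \<in> Ok i \<and> S i (p i (S i x)) = S i x" if "x \<in> Ok i" for i x
    unfolding p_def by (rule someI[of "\<lambda>y. y \<in> Ok i \<and> S i y = S i x" x]) (simp add: that)
  have "\<exists>c. inj_on c (Pow \<V>) \<and> (\<forall>T\<in>Pow \<V>. \<bar>c T - g i (p i T)\<bar> < \<eta>/2)" for i
    using V(1) \<eta> by (intro finite_inj_on_near) auto
  then obtain v where v: "\<And>i. inj_on (v i) (Pow \<V>)" "\<And>i T. T \<in> Pow \<V> \<Longrightarrow> \<bar>v i T - g i (p i T)\<bar> < \<eta>/2"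
    by metis
  have SPow: "S i x \<in> Pow \<V>" for i x by (auto simp: S_def)
  have close: "\<bar>v i (S i x) - g i x\<bar> \<le> \<eta>" if x: "x \<in> Ok i" and i: "i < N" for i x
  proof -
    have xX: "x \<in> topspace X" "p i (S i x) \<in> topspace X" using x p[OF x] by (auto simp: Ok_def)
    obtain V where VS: "V \<in> S i x" using S_ne[OF xX(1) i] by blast
    then have "V \<in> \<V>" "x \<in> V" "p i (S i x) \<in> V"
      using S_in[OF xX(1) i, of V] S_in[OF xX(2) i, of V] p[OF x] by auto
    then have "\<bar>g i x - g i (p i (S i x))\<bar> < \<eta>/2" using osc i by blast
    then show ?thesis using v(2)[OF SPow, of i i x] by linarith
  qed
  \<comment> \<open>Tietze is applied to the correction and not to the new function, because then
    the bound \<open>\<eta>\<close> survives the extension. Patterns are locally constant on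
    \<open>Ok i\<close>: a change of \<open>k V\<close> by less than \<open>\<delta>\<close> cannot
    cross the window around \<open>\<theta> i\<close>.\<close>
  have "\<exists>h. continuous_map X euclideanreal h \<and> (\<forall>x\<in>topspace X. \<bar>h x\<bar> \<le> \<eta>) \<and>
      (\<forall>x\<in>Ok i. h x = v i (S i x) - g i x)" if i: "i < N" for i
  proof -
    let ?X = "subtopology X (Ok i)"
    have Okt: "topspace ?X = Ok i" by (auto simp: Ok_def)
    have "continuous_map ?X euclideanreal (\<lambda>x. v i (S i x))"
    proof (rule continuous_map_realI)
      fix x and e :: real assume x: "x \<in> topspace ?X" and e: "0 < e"
      let ?T = "{y \<in> topspace X. \<forall>V\<in>\<V>. \<bar>k V y - k V x\<bar> < \<delta>}"
      have "openin X ?T" using V(1) k(1) by (intro openin_coordinate_box) auto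
      then have "openin ?X (?T \<inter> Ok i)" by (rule openin_subtopology_Int)
      moreover have "\<bar>v i (S i y) - v i (S i x)\<bar> < e" if "y \<in> ?T \<inter> Ok i" for y
      proof -
        have "\<theta> i + \<delta> \<le> k V y \<longleftrightarrow> \<theta> i + \<delta> \<le> k V x" if "V \<in> \<V>" for V
        proof -
          have "\<bar>k V y - k V x\<bar> < \<delta>" "k V y \<le> \<theta> i - \<delta> \<or> \<theta> i + \<delta> \<le> k V y"
            "k V x \<le> \<theta> i - \<delta> \<or> \<theta> i + \<delta> \<le> k V x"
            using \<open>y \<in> ?T \<inter> Ok i\<close> x that unfolding Okt by (auto simp: Ok_def ok_def)
          then show ?thesis by linarith
        qed
        then have "S i y = S i x" by (auto simp: S_def)
        then show ?thesis using e by simp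
      qed
      moreover have "x \<in> ?T \<inter> Ok i" using x \<delta> unfolding Okt by (auto simp: Ok_def)
      ultimately show "\<exists>U. openin ?X U \<and> x \<in> U \<and> (\<forall>y\<in>U. \<bar>v i (S i y) - v i (S i x)\<bar> < e)"
        by (intro exI[of _ "?T \<inter> Ok i"] conjI ballI)
    qed
    then have cont: "continuous_map ?X euclideanreal (\<lambda>x. v i (S i x) - g i x)"
      by (intro continuous_map_diff continuous_map_from_subtopology[OF g[OF i]])
    have im: "(\<lambda>x. v i (S i x) - g i x) ` Ok i \<subseteq> {-\<eta>..\<eta>}"
    proof
      fix t assume "t \<in> (\<lambda>x. v i (S i x) - g i x) ` Ok i"
      then obtain x where x: "x \<in> Ok i" "t = v i (S i x) - g i x" by blast
      show "t \<in> {-\<eta>..\<eta>}" using close[OF x(1) i] x(2) by (simp add: abs_le_iff)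
    qed
    have nX: "normal_space X" using X compact_Hausdorff_or_regular_imp_normal_space by blast
    have "-\<eta> \<le> \<eta>" using \<eta> by simp
    then obtain h where h: "continuous_map X euclideanreal h"
      "\<And>x. x \<in> Ok i \<Longrightarrow> h x = v i (S i x) - g i x" "h ` topspace X \<subseteq> {-\<eta>..\<eta>}"
      by (rule Tietze_extension_closed_real_interval[OF nX Ok_closed cont im]) (rule that; simp)
    have "\<bar>h x\<bar> \<le> \<eta>" if "x \<in> topspace X" for x
    proof -
      have "h x \<in> {-\<eta>..\<eta>}" using h(3) that by blast
      then show ?thesis by (simp add: abs_le_iff)
    qed
    with h show ?thesis by (intro exI[of _ h]) simp
  qed
  then obtain h where h: "\<And>i. i < N \<Longrightarrow> continuous_map X euclideanreal (h i)"
    "\<And>i x. i < N \<Longrightarrow> x \<in> topspace X \<Longrightarrow> \<bar>h i x\<bar> \<le> \<eta>"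
    "\<And>i x. i < N \<Longrightarrow> x \<in> Ok i \<Longrightarrow> h i x = v i (S i x) - g i x" by metis
  \<comment> \<open>Only finitely many patterns exist, so distances between different constants are
    bounded away from 0; this gives \<open>\<gamma>\<close>.\<close>
  let ?D = "(\<lambda>(i, T, T'). \<bar>v i T - v i T'\<bar>) ` ({..<N} \<times> {(T, T'). T \<in> Pow \<V> \<and> T' \<in> Pow \<V> \<and> T \<noteq> T'})"
  have fD: "finite ?D"
  proof -
    have "finite {(T, T'). T \<in> Pow \<V> \<and> T' \<in> Pow \<V> \<and> T \<noteq> T'}"
      by (rule finite_subset[of _ "Pow \<V> \<times> Pow \<V>"]) (use V(1) in auto)
    then show ?thesis by simp
  qed
  have pD: "0 < d" if dD: "d \<in> ?D" for d
  proof -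
    obtain q where q: "q \<in> {..<N} \<times> {(T, T'). T \<in> Pow \<V> \<and> T' \<in> Pow \<V> \<and> T \<noteq> T'}"
      "d = (case q of (i, T, T') \<Rightarrow> \<bar>v i T - v i T'\<bar>)" using dD by (elim imageE)
    obtain i T T' where "q = (i, T, T')" by (cases q) auto
    with q have d: "d = \<bar>v i T - v i T'\<bar>" "T \<in> Pow \<V>" "T' \<in> Pow \<V>" "T \<noteq> T'" by simp_all
    have "v i T = v i T' \<longleftrightarrow> T = T'" using v(1) d(2,3) by (rule inj_on_eq_iff)
    then show ?thesis using d(1,4) by simp
  qed
  have "\<exists>\<gamma>>0. \<forall>d\<in>?D. \<gamma> \<le> d" using fD pD by (rule finite_positive_lower_bound)
  then obtain \<gamma> where \<gamma>: "0 < \<gamma>" "\<forall>d\<in>?D. \<gamma> \<le> d" by (elim exE conjE)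
  show ?thesis
  proof (intro exI[of _ "\<lambda>i x. g i x + h i x"] exI[of _ \<gamma>] conjI allI impI ballI)
    show "0 < \<gamma>" by fact
    show "continuous_map X euclideanreal (\<lambda>x. g i x + h i x)" if "i < N" for i
      using g h(1) that by (intro continuous_map_add) auto
    show "\<bar>g i x + h i x - g i x\<bar> \<le> \<eta>" if "i < N" "x \<in> topspace X" for i x
      using h(2) that by simp
    fix x y assume xy: "x \<in> topspace X" "y \<in> topspace X" "\<not> common_member \<U> x y"
    obtain i where i: "i < N" "ok i x" "ok i y" using good xy by blast
    have Sxy: "S i x \<noteq> S i y"
    proof
      assume eq: "S i x = S i y"
      obtain V where "V \<in> S i x" using S_ne[OF xy(1) i(1)] by blast
      then have "V \<in> \<V>" "x \<in> V" "y \<in> V" using S_in[OF xy(1) i(1), of V] S_in[OF xy(2) i(1), of V] eq by auto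
      then show False using common i(1) xy(3) by blast
    qed
    have "\<bar>v i (S i x) - v i (S i y)\<bar> \<in> ?D"
      by (rule rev_image_eqI[of "(i, S i x, S i y)"]) (use i Sxy SPow in auto)
    then have "\<gamma> \<le> \<bar>v i (S i x) - v i (S i y)\<bar>" by (rule bspec[OF \<gamma>(2)])
    moreover have "x \<in> Ok i" "y \<in> Ok i" using i xy by (auto simp: Ok_def)
    ultimately show "\<exists>i<N. \<gamma> \<le> \<bar>g i x + h i x - (g i y + h i y)\<bar>"
      using h(3) i(1) by (intro exI[of _ i]) simp
  qed
qed

text \<open>Iterates \<open>perturbation_step\<close>, one cover at a time. The second component of
  a state is the budget for the next move. Budgets at least halve, so from state
  \<open>Suc n\<close> on a function moves by at most \<open>2 * e (Suc n)\<close> and a difference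
  of two values by at most \<open>4 * e (Suc n)\<close>. The gap \<open>8 * e (Suc n)\<close>
  secured for the cover \<open>\<U> n\<close> therefore survives in the limit.\<close>

lemma separating_functions_of_covers:
  fixes \<U> :: "nat \<Rightarrow> 'a set set"
  assumes X: "compact_space X" "Hausdorff_space X"
    and dim: "\<And>\<U>. finite \<U> \<Longrightarrow> open_cover_of X \<U> \<Longrightarrow> \<exists>\<V>. finite \<V> \<and> open_cover_of X \<V> \<and>
        refines \<V> \<U> \<and> (\<forall>x\<in>topspace X. card {V \<in> \<V>. x \<in> V} \<le> m)"
    and N: "N = 2 * m + 1"
    and U: "\<And>n. open_cover_of X (\<U> n)"
    and sep: "\<And>x y. x \<in> topspace X \<Longrightarrow> y \<in> topspace X \<Longrightarrow> x \<noteq> y \<Longrightarrow> \<exists>n. \<not> common_member (\<U> n) x y"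
  shows "\<exists>G :: nat \<Rightarrow> 'a \<Rightarrow> real. (\<forall>i<N. continuous_map X euclideanreal (G i)) \<and>
     (\<forall>x\<in>topspace X. \<forall>y\<in>topspace X. (\<forall>i<N. G i x = G i y) \<longrightarrow> x = y)"
proof -
  define P where "P p \<longleftrightarrow> (\<forall>i<N. continuous_map X euclideanreal (fst p i)) \<and> 0 < snd p"
    for p :: "(nat \<Rightarrow> 'a \<Rightarrow> real) \<times> real"
  define Q where "Q n p q \<longleftrightarrow> 2 * snd q \<le> snd p \<and>
     (\<forall>i<N. \<forall>x\<in>topspace X. \<bar>fst q i x - fst p i x\<bar> \<le> snd p) \<and>
     (\<forall>x\<in>topspace X. \<forall>y\<in>topspace X. \<not> common_member (\<U> n) x y \<longrightarrow>
        (\<exists>i<N. 8 * snd q \<le> \<bar>fst q i x - fst q i y\<bar>))"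
    for n and p q :: "(nat \<Rightarrow> 'a \<Rightarrow> real) \<times> real"
  have "\<exists>s. \<forall>n. P (s n) \<and> Q n (s n) (s (Suc n))"
  proof (rule dependent_nat_choice)
    have "P (\<lambda>_ _. 0, 1)" by (simp add: P_def)
    then show "\<exists>p. P p" by blast
  next
    fix p n assume "P p"
    then have p: "\<And>i. i < N \<Longrightarrow> continuous_map X euclideanreal (fst p i)" "0 < snd p" by (auto simp: P_def)
    have "\<exists>g' \<gamma>. 0 < \<gamma> \<and> (\<forall>i<N. continuous_map X euclideanreal (g' i)) \<and>
      (\<forall>i<N. \<forall>x\<in>topspace X. \<bar>g' i x - fst p i x\<bar> \<le> snd p) \<and>
      (\<forall>x\<in>topspace X. \<forall>y\<in>topspace X. \<not> common_member (\<U> n) x y \<longrightarrow> (\<exists>i<N. \<gamma> \<le> \<bar>g' i x - g' i y\<bar>))"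
      by (rule perturbation_step[OF X dim N p U])
    then obtain g' \<gamma> where g: "0 < \<gamma>" "\<forall>i<N. continuous_map X euclideanreal (g' i)"
      "\<forall>i<N. \<forall>x\<in>topspace X. \<bar>g' i x - fst p i x\<bar> \<le> snd p"
      "\<forall>x\<in>topspace X. \<forall>y\<in>topspace X. \<not> common_member (\<U> n) x y \<longrightarrow> (\<exists>i<N. \<gamma> \<le> \<bar>g' i x - g' i y\<bar>)"
      by (elim exE conjE)
    define e where "e = min (snd p / 2) (\<gamma> / 8)"
    have e: "0 < e" "2 * e \<le> snd p" "8 * e \<le> \<gamma>" using g(1) p(2) by (auto simp: e_def)
    have "P (g', e)" using g(2) e(1) by (simp add: P_def)
    moreover have "Q n p (g', e)"
      unfolding Q_def fst_conv snd_conv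
    proof (intro conjI ballI impI)
      fix x y assume xy: "x \<in> topspace X" "y \<in> topspace X" "\<not> common_member (\<U> n) x y"
      then obtain i where "i < N" "\<gamma> \<le> \<bar>g' i x - g' i y\<bar>" using g(4) by blast
      then show "\<exists>i<N. 8 * e \<le> \<bar>g' i x - g' i y\<bar>" using e(3) by (intro exI[of _ i]) simp
    qed (use e(2) g(3) in simp_all)
    ultimately show "\<exists>q. P q \<and> Q n p q" by blast
  qed
  then obtain s where s: "\<And>n. P (s n)" "\<And>n. Q n (s n) (s (Suc n))" by blast
  define g where "g n = fst (s n)" for n
  define e where "e n = snd (s n)" for n
  have g_cont: "continuous_map X euclideanreal (g n i)" and e_pos: "0 < e n" if "i < N" for n i
    using s(1)[of n] that by (simp_all add: P_def g_def e_def)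
  have e_half: "2 * e (Suc n) \<le> e n" for n using s(2)[of n] by (simp add: Q_def e_def)
  have g_step: "\<bar>g (Suc n) i x - g n i x\<bar> \<le> e n" if "i < N" "x \<in> topspace X" for n i x
    using s(2)[of n] that by (simp add: Q_def g_def e_def)
  have g_sep: "\<exists>i<N. 8 * e (Suc n) \<le> \<bar>g (Suc n) i x - g (Suc n) i y\<bar>"
    if "x \<in> topspace X" "y \<in> topspace X" "\<not> common_member (\<U> n) x y" for n x y
    using s(2)[of n] that by (simp add: Q_def g_def e_def)
  have N0: "0 < N" using N by simp
  \<comment> \<open>The subtracted term makes the induction close: the next move
    \<open>e (n + l)\<close> is paid for by halving the budget.\<close>
  have g_near: "\<bar>g (n + l) i x - g n i x\<bar> \<le> 2 * e n - 2 * e (n + l)"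
    if "i < N" "x \<in> topspace X" for n l i x
  proof (induction l)
    case (Suc l)
    have "\<bar>g (Suc (n + l)) i x - g (n + l) i x\<bar> \<le> e (n + l)" using g_step[OF that] .
    then show ?case using Suc e_half[of "n + l"] by simp
  qed simp
  have e_le: "e n \<le> (1/2)^n * e 0" for n
  proof (induction n)
    case (Suc n)
    then show ?case using e_half[of n] by simp
  qed simp
  have e_lim: "(\<lambda>n. 2 * e n) \<longlonglongrightarrow> 0"
  proof (rule tendsto_sandwich[OF _ _ tendsto_const])
    show "\<forall>\<^sub>F n in sequentially. 0 \<le> 2 * e n" using e_pos[OF N0] by (simp add: less_imp_le)
    show "\<forall>\<^sub>F n in sequentially. 2 * e n \<le> 2 * ((1/2)^n * e 0)" using e_le by simp
    show "(\<lambda>n. 2 * ((1/2)^n * e 0)) \<longlonglongrightarrow> 0"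
      by (intro tendsto_mult_right_zero tendsto_mult_left_zero LIMSEQ_power_zero) simp
  qed
  define G where "G i x = lim (\<lambda>n. g n i x)" for i x
  have G_near: "\<bar>g n i x - G i x\<bar> \<le> 2 * e n" if ix: "i < N" "x \<in> topspace X" for n i x
  proof -
    have near: "\<bar>g l i x - g n i x\<bar> \<le> 2 * e n" if "n \<le> l" for n l
      using g_near[OF ix, of n "l - n"] e_pos[OF N0, of l] that by simp
    have "Cauchy (\<lambda>n. g n i x)"
    proof (rule metric_CauchyI)
      fix r :: real assume "0 < r"
      then have "\<forall>\<^sub>F n in sequentially. 2 * e n < r / 2" by (intro order_tendstoD(2)[OF e_lim]) simp
      then obtain M where M: "2 * e M < r / 2" by (auto simp: eventually_sequentially)
      have "dist (g a i x) (g b i x) < r" if "M \<le> a" "M \<le> b" for a b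
        using near[OF that(1)] near[OF that(2)] M by (simp add: dist_real_def)
      then show "\<exists>M. \<forall>a\<ge>M. \<forall>b\<ge>M. dist (g a i x) (g b i x) < r" by blast
    qed
    then have lim: "(\<lambda>n. g n i x) \<longlonglongrightarrow> G i x"
      unfolding G_def by (simp add: Cauchy_convergent_iff convergent_LIMSEQ_iff)
    have "(\<lambda>l. \<bar>g n i x - g l i x\<bar>) \<longlonglongrightarrow> \<bar>g n i x - G i x\<bar>"
      by (intro tendsto_rabs tendsto_diff tendsto_const lim)
    then show ?thesis
    proof (rule LIMSEQ_le_const2)
      show "\<exists>M. \<forall>l\<ge>M. \<bar>g n i x - g l i x\<bar> \<le> 2 * e n" 
        using near[of n] by (intro exI[of _ n] allI impI) (subst abs_minus_commute, blast)
    qed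
  qed
  show ?thesis
  proof (intro exI[of _ G] conjI allI impI ballI)
    show "continuous_map X euclideanreal (G i)" if "i < N" for i
      by (rule continuous_map_real_uniform_limit[OF g_cont[OF that] G_near[OF that] e_lim])
    fix x y assume xy: "x \<in> topspace X" "y \<in> topspace X" "\<forall>i<N. G i x = G i y"
    show "x = y"
    proof (rule ccontr)
      assume "x \<noteq> y"
      then obtain n where "\<not> common_member (\<U> n) x y" using sep xy by blast
      then obtain i where i: "i < N" "8 * e (Suc n) \<le> \<bar>g (Suc n) i x - g (Suc n) i y\<bar>"
        using g_sep xy by blast
      show False
        using i(2) G_near[OF i(1) xy(1), of "Suc n"] G_near[OF i(1) xy(2), of "Suc n"] xy(3) i(1)
          e_pos[OF N0, of "Suc n"] by auto
    qed
  qed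
qed

text \<open>For basic sets with the closure of \<open>B\<close> inside \<open>B'\<close>, the cover
  by \<open>B'\<close> and the complement of that closure separates points of \<open>B\<close> from
  points outside \<open>B'\<close>. Countably many pairs are enumerated; the trivial cover serves as
  default for all other pairs.\<close>

lemma separating_covers:
  assumes X: "compact_space X" "Hausdorff_space X" and sc: "second_countable X"
  shows "\<exists>\<U> :: nat \<Rightarrow> 'a set set. (\<forall>n. open_cover_of X (\<U> n)) \<and>
    (\<forall>x\<in>topspace X. \<forall>y\<in>topspace X. x \<noteq> y \<longrightarrow> (\<exists>n. \<not> common_member (\<U> n) x y))"
proof -
  obtain \<B> where B: "countable \<B>" "\<And>B. B \<in> \<B> \<Longrightarrow> openin X B"
    "\<And>U x. openin X U \<Longrightarrow> x \<in> U \<Longrightarrow> \<exists>B\<in>\<B>. x \<in> B \<and> B \<subseteq> U"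
    using sc unfolding second_countable_def by auto
  define c where "c = (\<lambda>(B, B'). if B' \<in> \<B> \<and> X closure_of B \<subseteq> B' then {B', topspace X - X closure_of B}
     else {topspace X})"
  have c: "open_cover_of X (c p)" for p
  proof (cases p)
    case (Pair B B')
    have "openin X (topspace X - X closure_of B)" by (simp add: openin_diff)
    moreover have "openin X B'" "B' \<subseteq> topspace X" if "B' \<in> \<B>" using B(2)[OF that] openin_subset by auto
    ultimately show ?thesis unfolding Pair c_def open_cover_of_def by auto
  qed
  define \<U> where "\<U> n = c (from_nat_into (\<B> \<times> \<B>) n)" for n
  have "\<exists>n. \<not> common_member (\<U> n) x y" if xy: "x \<in> topspace X" "y \<in> topspace X" "x \<noteq> y" for x y
  proof -
    have "t1_space X" using X(2) Hausdorff_imp_t1_space by blast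
    then have "closedin X {y}" using xy(2) by (simp add: closedin_t1_singleton)
    then have "openin X (topspace X - {y})" by blast
    then obtain B' where B': "B' \<in> \<B>" "x \<in> B'" "B' \<subseteq> topspace X - {y}" using B(3) xy by blast
    have reg: "regular_space X" using X compact_Hausdorff_imp_regular_space by blast
    obtain U V where UV: "openin X U" "closedin X V" "x \<in> U" "U \<subseteq> V" "V \<subseteq> B'"
      using regular_space_shrink[OF reg B(2)[OF B'(1)] B'(2)] by blast
    obtain B where B0: "B \<in> \<B>" "x \<in> B" "B \<subseteq> U" using B(3)[OF UV(1,3)] by blast
    have "X closure_of B \<subseteq> V" using B0(3) UV by (intro closure_of_minimal) auto
    then have "X closure_of B \<subseteq> B'" using UV(5) by blast
    then have "c (B, B') = {B', topspace X - X closure_of B}" using B'(1) by (simp add: c_def)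
    moreover have "x \<in> X closure_of B"
      using closure_of_subset[of B X] openin_subset[OF B(2)[OF B0(1)]] B0(2) by blast
    ultimately have "\<not> common_member (c (B, B')) x y" using B'(3) by (auto simp: common_member_def)
    moreover have "\<exists>n. from_nat_into (\<B> \<times> \<B>) n = (B, B')"
      using B(1) B0(1) B'(1) from_nat_into_surj[of "\<B> \<times> \<B>" "(B, B')"] by auto
    ultimately show ?thesis unfolding \<U>_def by metis
  qed
  then show ?thesis using c by (intro exI[of _ \<U>]) (simp add: \<U>_def)
qed

text \<open>With dimension at most \<open>n\<close> this uses \<open>2 * (n + 1) + 1\<close>
  functions, two more than the classical embedding needs; the surplus is the price of counting bad
  thresholds instead of placing simplices in general position.\<close>

proposition finite_separating_functions:
  assumes X: "compact_space X" "Hausdorff_space X" "second_countable X"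
    and fd: "finite_dimensional_space X"
  shows "\<exists>(N::nat) G :: nat \<Rightarrow> 'a \<Rightarrow> real. (\<forall>i<N. continuous_map X euclideanreal (G i)) \<and>
     (\<forall>x\<in>topspace X. \<forall>y\<in>topspace X. (\<forall>i<N. G i x = G i y) \<longrightarrow> x = y)"
proof -
  obtain n where n: "covering_dim_le X n" using fd by (auto simp: finite_dimensional_space_def)
  have dim: "\<exists>\<V>. finite \<V> \<and> open_cover_of X \<V> \<and> refines \<V> \<U> \<and>
      (\<forall>x\<in>topspace X. card {V \<in> \<V>. x \<in> V} \<le> nat (n + 1))"
    if "finite \<U>" "open_cover_of X \<U>" for \<U>
  proof -
    obtain \<V> where V: "finite \<V>" "open_cover_of X \<V>" "refines \<V> \<U>"
      "\<forall>x\<in>topspace X. int (card {V \<in> \<V>. x \<in> V}) \<le> n + 1"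
      using n \<open>finite \<U>\<close> \<open>open_cover_of X \<U>\<close> unfolding covering_dim_le_def by metis
    have "card {V \<in> \<V>. x \<in> V} \<le> nat (n + 1)" if "x \<in> topspace X" for x
      using bspec[OF V(4) that] by simp
    with V show ?thesis by blast
  qed
  obtain \<U> :: "nat \<Rightarrow> 'a set set" where U: "\<forall>n. open_cover_of X (\<U> n)"
    "\<forall>x\<in>topspace X. \<forall>y\<in>topspace X. x \<noteq> y \<longrightarrow> (\<exists>n. \<not> common_member (\<U> n) x y)"
    using separating_covers[OF X] by blast
  have "\<exists>G :: nat \<Rightarrow> 'a \<Rightarrow> real. (\<forall>i<2 * nat (n + 1) + 1. continuous_map X euclideanreal (G i)) \<and>
     (\<forall>x\<in>topspace X. \<forall>y\<in>topspace X. (\<forall>i<2 * nat (n + 1) + 1. G i x = G i y) \<longrightarrow> x = y)"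
    using U by (intro separating_functions_of_covers[OF X(1,2) dim refl, of \<U>]) auto
  then show ?thesis by blast
qed

lemma finite_dimensional_space_closed_subtopology:
  assumes fd: "finite_dimensional_space X" and C: "closedin X C"
  shows "finite_dimensional_space (subtopology X C)"
proof -
  obtain n where n: "covering_dim_le X n" using fd by (auto simp: finite_dimensional_space_def)
  have CX: "C \<subseteq> topspace X" using C closedin_subset by blast
  have topC: "topspace (subtopology X C) = C" using CX by auto
  have "\<exists>\<V>. finite \<V> \<and> open_cover_of (subtopology X C) \<V> \<and> refines \<V> \<U> \<and>
        (\<forall>x\<in>topspace (subtopology X C). int (card {V \<in> \<V>. x \<in> V}) \<le> n + 1)"
    if U: "finite \<U>" "open_cover_of (subtopology X C) \<U>" for \<U>
  proof -
    have "\<exists>T. openin X T \<and> T \<inter> C = U" if "U \<in> \<U>" for U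
      using U(2) that unfolding open_cover_of_def openin_subtopology by metis
    then obtain T where T: "\<And>U. U \<in> \<U> \<Longrightarrow> openin X (T U) \<and> T U \<inter> C = U" by metis
    let ?\<T> = "insert (topspace X - C) (T ` \<U>)"
    have UC: "\<Union>\<U> = C" using U(2) topC by (simp add: open_cover_of_def)
    have "open_cover_of X ?\<T>"
      unfolding open_cover_of_def
    proof (intro conjI ballI)
      show "openin X W" if "W \<in> ?\<T>" for W using that T C by (auto simp: openin_diff)
      then have "\<Union>?\<T> \<subseteq> topspace X" using openin_subset by (meson Union_least)
      moreover have "topspace X \<subseteq> \<Union>?\<T>"
      proof
        fix x assume "x \<in> topspace X"
        show "x \<in> \<Union>?\<T>"
        proof (cases "x \<in> C")
          case True
          then obtain U' where "U' \<in> \<U>" "x \<in> U'" using UC by blast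
          then have "x \<in> T U'" using T by blast
          then show ?thesis using \<open>U' \<in> \<U>\<close> by blast
        qed (use \<open>x \<in> topspace X\<close> in blast)
      qed
      ultimately show "\<Union>?\<T> = topspace X" by (rule equalityI)
    qed
    moreover have "finite ?\<T>" using U(1) by simp
    ultimately obtain \<V> where V: "finite \<V>" "open_cover_of X \<V>" "refines \<V> ?\<T>"
      "\<forall>x\<in>topspace X. int (card {V \<in> \<V>. x \<in> V}) \<le> n + 1"
      using n unfolding covering_dim_le_def by metis
    \<comment> \<open>Members with empty trace are dropped, since they may lie only in the added set
      \<open>topspace X - C\<close> and \<open>\<U>\<close> might have no member at all to contain
      the trace.\<close>
    define \<V>' where "\<V>' = (\<lambda>V. V \<inter> C) ` {V \<in> \<V>. V \<inter> C \<noteq> {}}"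
    have "finite \<V>'" using V(1) by (simp add: \<V>'_def)
    moreover have "open_cover_of (subtopology X C) \<V>'"
      unfolding open_cover_of_def topC
    proof (intro conjI ballI)
      show "openin (subtopology X C) W" if "W \<in> \<V>'" for W
        using that V(2) by (auto simp: \<V>'_def open_cover_of_def intro: openin_subtopology_Int)
      have "\<Union>\<V> = topspace X" using V(2) by (simp add: open_cover_of_def)
      then show "\<Union>\<V>' = C" using CX unfolding \<V>'_def by blast
    qed
    moreover have "refines \<V>' \<U>"
      unfolding refines_def
    proof
      fix W assume "W \<in> \<V>'"
      then obtain V where V': "V \<in> \<V>" "V \<inter> C \<noteq> {}" "W = V \<inter> C" by (auto simp: \<V>'_def)
      have "\<exists>S\<in>?\<T>. V \<subseteq> S" using V(3) V'(1) unfolding refines_def by (rule bspec)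
      then obtain S where S: "S \<in> ?\<T>" "V \<subseteq> S" by (elim bexE)
      have "S \<noteq> topspace X - C"
      proof
        assume "S = topspace X - C"
        then have "V \<inter> C = {}" using S(2) by blast
        then show False using V'(2) by simp
      qed
      then obtain U' where "U' \<in> \<U>" "S = T U'" using S(1) by blast
      then have "S \<inter> C = U'" using T by simp
      then have "W \<subseteq> U'" using S(2) V'(3) by blast
      then show "\<exists>U\<in>\<U>. W \<subseteq> U" using \<open>U' \<in> \<U>\<close> by blast
    qed
    moreover have "int (card {W \<in> \<V>'. x \<in> W}) \<le> n + 1" if x: "x \<in> C" for x
    proof -
      have "{W \<in> \<V>'. x \<in> W} \<subseteq> (\<lambda>V. V \<inter> C) ` {V \<in> \<V>. x \<in> V}" by (auto simp: \<V>'_def)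
      then have "card {W \<in> \<V>'. x \<in> W} \<le> card {V \<in> \<V>. x \<in> V}"
        using V(1) by (intro surj_card_le[of "{V \<in> \<V>. x \<in> V}"]) auto
      also have "int (card {V \<in> \<V>. x \<in> V}) \<le> n + 1" using V(4) x CX by blast
      finally show ?thesis by simp
    qed
    ultimately show ?thesis unfolding topC by blast
  qed
  then have "covering_dim_le (subtopology X C) n"
    using n unfolding covering_dim_le_def by simp
  then show ?thesis by (auto simp: finite_dimensional_space_def)
qed

section \<open>The implications\<close>

lemma compact_metrizable_imp_second_countable:
  assumes "compact_space X" "metrizable_space X"
  shows "second_countable X"
proof -
  obtain M d where Md: "Metric_space M d" and X: "X = Metric_space.mtopology M d"
    using assms(2) metrizable_space_def by blast
  interpret Metric_space M d by (fact Md)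
  have "mtotally_bounded M"
    using assms(1) unfolding X compact_space_eq_mcomplete_mtotally_bounded by blast
  then have "\<exists>C. finite C \<and> C \<subseteq> M \<and> M \<subseteq> (\<Union>x\<in>C. mball x (inverse (real (Suc n))))" for n
    unfolding mtotally_bounded_def by simp
  then obtain C where C: "\<And>n. finite (C n)" "\<And>n. C n \<subseteq> M"
    "\<And>n. M \<subseteq> (\<Union>x\<in>C n. mball x (inverse (real (Suc n))))" by metis
  define \<B> where "\<B> = (\<Union>n. (\<lambda>x. mball x (inverse (real (Suc n)))) ` C n)"
  show ?thesis
    unfolding second_countable_def X
  proof (intro exI[of _ \<B>] conjI allI impI ballI)
    show "countable \<B>" unfolding \<B>_def using C(1) by (intro countable_UN countable_image) (auto intro: countable_finite)
    show "openin mtopology V" if "V \<in> \<B>" for V using that by (auto simp: \<B>_def)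
    fix U x assume U: "openin mtopology U \<and> x \<in> U"
    then obtain r where r: "0 < r" "mball x r \<subseteq> U" and xM: "x \<in> M" by (meson openin_mtopology subsetD)
    obtain n where n: "inverse (real (Suc n)) < r / 2" using reals_Archimedean[of "r/2"] r by auto
    obtain z where z: "z \<in> C n" "x \<in> mball z (inverse (real (Suc n)))" using C(3)[of n] xM by blast
    have "mball z (inverse (real (Suc n))) \<subseteq> mball x r"
    proof
      fix y assume y: "y \<in> mball z (inverse (real (Suc n)))"
      have "d x y \<le> d x z + d z y" using triangle z y by simp
      then show "y \<in> mball x r" using y z n commute[of x z] by simp
    qed
    then show "\<exists>V\<in>\<B>. x \<in> V \<and> V \<subseteq> U" using z r(2) unfolding \<B>_def by blast
  qed
qed

section \<open>Gluing point-finite separating families\<close>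

text \<open>Metacompactness of the open subspace \<open>\<Union>\<O>\<close> is applied to open sets
  whose closures in \<open>K\<close> stay inside \<open>\<Union>\<O>\<close>. Refinements inherit
  this, and it is the closure hypothesis of the shrinking lemma.\<close>

lemma hereditarily_metacompact_cozero_refinement:
  assumes K: "compact_space K" "Hausdorff_space K" and hm: "hereditarily_metacompact_space K"
    and op: "\<And>V. V \<in> \<O> \<Longrightarrow> openin K V"
  shows "\<exists>\<V> k. (\<forall>V\<in>\<V>. \<exists>W\<in>\<O>. V \<subseteq> W) \<and> \<Union>\<V> = \<Union>\<O> \<and>
    (\<forall>x\<in>\<Union>\<O>. finite {V \<in> \<V>. x \<in> V}) \<and>
    (\<forall>V\<in>\<V>. continuous_map K euclideanreal (k V)) \<and>
    (\<forall>V\<in>\<V>. \<forall>x\<in>topspace K - V. k V x = (0::real)) \<and>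
    (\<forall>x\<in>\<Union>\<O>. \<exists>V\<in>\<V>. 0 < k V x)"
proof -
  have Wo: "openin K (\<Union>\<O>)" using op by blast
  then have WK: "\<Union>\<O> \<subseteq> topspace K" by (rule openin_subset)
  have topW: "topspace (subtopology K (\<Union>\<O>)) = \<Union>\<O>" using WK by auto
  have reg: "regular_space K" using K compact_Hausdorff_imp_regular_space by blast
  define \<U> where "\<U> = {U. openin K U \<and> (\<exists>W\<in>\<O>. U \<subseteq> W) \<and> K closure_of U \<subseteq> \<Union>\<O>}"
  have "open_cover_of (subtopology K (\<Union>\<O>)) \<U>"
    unfolding open_cover_of_def topW
  proof (intro conjI ballI)
    show "openin (subtopology K (\<Union>\<O>)) U" if "U \<in> \<U>" for U
      using that Wo by (auto simp: \<U>_def openin_open_subtopology)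
    have "\<exists>U\<in>\<U>. x \<in> U" if x: "W \<in> \<O>" "x \<in> W" for x W
    proof -
      obtain U V where UV: "openin K U" "closedin K V" "x \<in> U" "U \<subseteq> V" "V \<subseteq> W"
        using regular_space_shrink[OF reg op[OF x(1)] x(2)] by blast
      have "K closure_of U \<subseteq> V" using UV by (intro closure_of_minimal)
      then have "U \<in> \<U>" using UV x(1) unfolding \<U>_def by blast
      then show ?thesis using UV(3) by blast
    qed
    then have "\<Union>\<O> \<subseteq> \<Union>\<U>" by (intro subsetI) (elim UnionE, simp)
    moreover have "U \<subseteq> \<Union>\<O>" if "U \<in> \<U>" for U using that by (auto simp: \<U>_def)
    ultimately show "\<Union>\<U> = \<Union>\<O>" by (meson Union_least equalityI)
  qed
  moreover have "metacompact_space (subtopology K (\<Union>\<O>))"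
    using hm WK by (simp add: hereditarily_metacompact_space_def)
  ultimately obtain \<V> where V: "open_cover_of (subtopology K (\<Union>\<O>)) \<V>" "refines \<V> \<U>"
    "\<forall>x\<in>topspace (subtopology K (\<Union>\<O>)). finite {V \<in> \<V>. x \<in> V}"
    unfolding metacompact_space_def by blast
  have VU: "\<Union>\<V> = \<Union>\<O>" using V(1) unfolding open_cover_of_def topW by blast
  have Vo: "openin K V" if "V \<in> \<V>" for V
    using V(1) that Wo unfolding open_cover_of_def by (simp add: openin_open_subtopology)
  have VW: "\<exists>W\<in>\<O>. V \<subseteq> W" and Vcl: "K closure_of V \<subseteq> \<Union>\<V>" if VV: "V \<in> \<V>" for V
  proof -
    obtain U where U: "U \<in> \<U>" "V \<subseteq> U" using V(2) VV unfolding refines_def by blast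
    then show "\<exists>W\<in>\<O>. V \<subseteq> W" unfolding \<U>_def by blast
    have "K closure_of V \<subseteq> K closure_of U" using U(2) by (rule closure_of_mono)
    also have "\<dots> \<subseteq> \<Union>\<O>" using U(1) by (simp add: \<U>_def)
    finally show "K closure_of V \<subseteq> \<Union>\<V>" by (simp add: VU)
  qed
  have fin: "finite {V \<in> \<V>. x \<in> V}" if "x \<in> \<Union>\<O>" for x using V(3) that unfolding topW by blast
  have "\<exists>k. (\<forall>V\<in>\<V>. continuous_map K euclideanreal (k V) \<and>
           (\<forall>x\<in>topspace K. 0 \<le> k V x) \<and> (\<forall>x\<in>topspace K - V. k V x = (0::real))) \<and>
         (\<forall>x\<in>\<Union>\<V>. \<exists>V\<in>\<V>. 0 < k V x)"
    using Vo Vcl fin VU by (intro point_finite_cozero_shrinking[OF K]) simp_all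
  then obtain k where k: "\<forall>V\<in>\<V>. continuous_map K euclideanreal (k V) \<and>
           (\<forall>x\<in>topspace K. 0 \<le> k V x) \<and> (\<forall>x\<in>topspace K - V. k V x = (0::real))"
         "\<forall>x\<in>\<Union>\<V>. \<exists>V\<in>\<V>. 0 < k V x" by (elim exE conjE)
  show ?thesis
    by (intro exI[of _ \<V>] exI[of _ k] conjI) (use VW VU fin k in simp_all)
qed

text \<open>The conclusion is stronger than goodness of the union: the family is point-finite on all
  of \<open>K\<close>, and it separates points of the union from points outside. Both are needed
  when a piece of the complement is added later.\<close>

lemma separating_family_Union:
  assumes K: "compact_space K" "Hausdorff_space K" and hm: "hereditarily_metacompact_space K"
    and op: "\<And>V. V \<in> \<O> \<Longrightarrow> openin K V \<and> (\<exists>F. separating_family K V F)"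
  shows "\<exists>F. separating_family K (\<Union>\<O>) F \<and> (\<forall>x\<in>topspace K. finite {f \<in> F. f x \<noteq> 0}) \<and>
      (\<forall>x\<in>\<Union>\<O>. \<forall>y\<in>topspace K. x \<noteq> y \<longrightarrow> (\<exists>f\<in>F. f x \<noteq> f y))"
proof -
  have "\<exists>\<V> k. (\<forall>V\<in>\<V>. \<exists>W\<in>\<O>. V \<subseteq> W) \<and> \<Union>\<V> = \<Union>\<O> \<and>
    (\<forall>x\<in>\<Union>\<O>. finite {V \<in> \<V>. x \<in> V}) \<and>
    (\<forall>V\<in>\<V>. continuous_map K euclideanreal (k V)) \<and>
    (\<forall>V\<in>\<V>. \<forall>x\<in>topspace K - V. k V x = (0::real)) \<and>
    (\<forall>x\<in>\<Union>\<O>. \<exists>V\<in>\<V>. 0 < k V x)"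
    by (rule hereditarily_metacompact_cozero_refinement[OF K hm]) (use op in blast)
  then obtain \<V> k where *: "\<forall>V\<in>\<V>. \<exists>W\<in>\<O>. V \<subseteq> W" "\<Union>\<V> = \<Union>\<O>"
    "\<forall>x\<in>\<Union>\<O>. finite {V \<in> \<V>. x \<in> V}"
    "\<forall>V\<in>\<V>. continuous_map K euclideanreal (k V)"
    "\<forall>V\<in>\<V>. \<forall>x\<in>topspace K - V. k V x = (0::real)"
    "\<forall>x\<in>\<Union>\<O>. \<exists>V\<in>\<V>. 0 < k V x" by (elim exE conjE)
  note V = *(1)[rule_format] *(2) *(3)[rule_format]
  note k = *(4)[rule_format] *(5)[rule_format] *(6)[rule_format]
  have "\<exists>F. separating_family K V F" if VV: "V \<in> \<V>" for V
  proof -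
    obtain W where W: "W \<in> \<O>" "V \<subseteq> W" using V(1)[OF VV] by (elim bexE)
    obtain F where F: "separating_family K W F" using op[OF W(1)] by blast
    have "separating_family K V F"
      unfolding separating_family_def
    proof (intro conjI ballI)
      show "continuous_map K euclideanreal f" if "f \<in> F" for f
        using F that by (simp add: separating_family_def)
      show "finite {f \<in> F. f x \<noteq> 0}" if "x \<in> V" for x
        using F W(2) that by (auto simp: separating_family_def)
      have "\<forall>x\<in>W. \<forall>y\<in>W. x \<noteq> y \<longrightarrow> (\<exists>f\<in>F. f x \<noteq> f y)"
        using F by (simp add: separating_family_def)
      then show "x \<noteq> y \<longrightarrow> (\<exists>f\<in>F. f x \<noteq> f y)" if "x \<in> V" "y \<in> V" for x y
        using W(2) that by (metis subsetD)
    qed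
    then show ?thesis by (rule exI)
  qed
  then obtain F where F: "\<And>V. V \<in> \<V> \<Longrightarrow> separating_family K V (F V)" by metis
  have FV: "\<And>f. f \<in> F V \<Longrightarrow> continuous_map K euclideanreal f"
    "\<And>x. x \<in> V \<Longrightarrow> finite {f \<in> F V. f x \<noteq> 0}" if "V \<in> \<V>" for V
    using F[OF that] by (simp_all add: separating_family_def)
  have Fsep: "\<exists>f\<in>F V. f x \<noteq> f y" if "V \<in> \<V>" "x \<in> V" "y \<in> V" "x \<noteq> y" for V x y
    using F[OF that(1)] that unfolding separating_family_def by metis
  \<comment> \<open>Take \<open>V\<close> with \<open>k V x\<close> positive. Either
    \<open>k V\<close> itself separates \<open>x\<close> from \<open>y\<close>, or the equal
    positive values place both points in \<open>V\<close>, and multiplication by them preserves the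
    separation by a member of \<open>F V\<close>.\<close>
  define H where "H V = insert (k V) ((\<lambda>f x. k V x * f x) ` F V)" for V
  define \<F> where "\<F> = (\<Union>V\<in>\<V>. H V)"
  have cont: "continuous_map K euclideanreal f" if "f \<in> \<F>" for f
    using that k(1) FV(1) by (auto simp: \<F>_def H_def intro!: continuous_intros)
  have fin: "finite {f \<in> \<F>. f x \<noteq> 0}" if x: "x \<in> topspace K" for x
  proof (rule finite_subset)
    show "{f \<in> \<F>. f x \<noteq> 0} \<subseteq>
      (\<Union>V\<in>{V \<in> \<V>. x \<in> V}. insert (k V) ((\<lambda>f x. k V x * f x) ` {f \<in> F V. f x \<noteq> 0}))"
    proof
      fix f assume f: "f \<in> {f \<in> \<F>. f x \<noteq> 0}"
      then obtain V where VV: "V \<in> \<V>" "f \<in> H V" by (auto simp: \<F>_def)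
      have "x \<in> V"
      proof (rule ccontr)
        assume "x \<notin> V"
        then have "k V x = 0" using k(2)[OF VV(1)] x by blast
        then show False using VV(2) f by (auto simp: H_def)
      qed
      then show "f \<in> (\<Union>V\<in>{V \<in> \<V>. x \<in> V}. insert (k V) ((\<lambda>f x. k V x * f x) ` {f \<in> F V. f x \<noteq> 0}))"
        using VV f by (auto simp: H_def)
    qed
    have "finite {V \<in> \<V>. x \<in> V}"
    proof (cases "x \<in> \<Union>\<O>")
      case False
      then have "{V \<in> \<V>. x \<in> V} = {}" using V(2) by blast
      then show ?thesis by (simp only: finite.emptyI)
    qed (rule V(3))
    then show "finite (\<Union>V\<in>{V \<in> \<V>. x \<in> V}. insert (k V) ((\<lambda>f x. k V x * f x) ` {f \<in> F V. f x \<noteq> 0}))"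
      using FV(2) by (intro finite_UN_I) auto
  qed
  have sep: "\<exists>f\<in>\<F>. f x \<noteq> f y" if xy: "x \<in> \<Union>\<O>" "y \<in> topspace K" "x \<noteq> y" for x y
  proof -
    obtain V where VV: "V \<in> \<V>" "0 < k V x" using k(3)[OF xy(1)] by blast
    have WK: "x \<in> topspace K" using xy(1) op openin_subset by blast
    have kF: "k V \<in> \<F>" using VV(1) by (auto simp: \<F>_def H_def)
    show ?thesis
    proof (cases "k V x = k V y")
      case True
      have "x \<in> V" using k(2)[OF VV(1), of x] VV(2) WK by force
      moreover have "y \<in> V" using k(2)[OF VV(1), of y] VV(2) xy(2) True by force
      ultimately obtain f where f: "f \<in> F V" "f x \<noteq> f y" using Fsep[OF VV(1)] xy(3) by blast
      have "(\<lambda>x. k V x * f x) \<in> \<F>" using VV(1) f(1) by (auto simp: \<F>_def H_def)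
      moreover have "k V x * f x \<noteq> k V y * f y" using True VV(2) f(2) by simp
      ultimately show ?thesis by (intro bexI[of _ "\<lambda>x. k V x * f x"])
    qed (use kF in blast)
  qed
  have OK: "\<Union>\<O> \<subseteq> topspace K" using op openin_subset by blast
  have "separating_family K (\<Union>\<O>) \<F>"
    unfolding separating_family_def
  proof (intro conjI ballI impI)
    show "continuous_map K euclideanreal f" if "f \<in> \<F>" for f using cont[OF that] .
    show "finite {f \<in> \<F>. f x \<noteq> 0}" if "x \<in> \<Union>\<O>" for x using fin that OK by blast
    show "\<exists>f\<in>\<F>. f x \<noteq> f y" if "x \<in> \<Union>\<O>" "y \<in> \<Union>\<O>" "x \<noteq> y" for x y using sep that OK by blast
  qed
  then show ?thesis using fin sep by (intro exI[of _ \<F>]) simp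
qed

lemma hereditarily_metacompact_imp_omega_corson:
  assumes K: "compact_space K" "Hausdorff_space K" and hm: "hereditarily_metacompact_space K"
    and loc: "\<And>A. A \<subseteq> topspace K \<Longrightarrow> A \<noteq> {} \<Longrightarrow> \<exists>U. U \<noteq> {} \<and> openin (subtopology K A) U \<and>
              finite_dimensional_space (subtopology K U) \<and> second_countable (subtopology K U)"
  shows "omega_corson K"
proof -
  define \<O> where "\<O> = {V. openin K V \<and> (\<exists>F. separating_family K V F)}"
  define W where "W = \<Union>\<O>"
  have Wo: "openin K W" unfolding W_def \<O>_def by blast
  have "\<exists>F. separating_family K (\<Union>\<O>) F \<and> (\<forall>x\<in>topspace K. finite {f \<in> F. f x \<noteq> 0}) \<and>
      (\<forall>x\<in>\<Union>\<O>. \<forall>y\<in>topspace K. x \<noteq> y \<longrightarrow> (\<exists>f\<in>F. f x \<noteq> f y))"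
    by (rule separating_family_Union[OF K hm]) (simp add: \<O>_def)
  then obtain F where F: "separating_family K W F" and Ffin: "\<forall>x\<in>topspace K. finite {f \<in> F. f x \<noteq> 0}"
    and Fsep: "\<forall>x\<in>W. \<forall>y\<in>topspace K. x \<noteq> y \<longrightarrow> (\<exists>f\<in>F. f x \<noteq> f y)"
    unfolding W_def by (elim exE conjE)
  have Fc: "continuous_map K euclideanreal f" if "f \<in> F" for f
    using F that by (simp add: separating_family_def)
  have "W = topspace K"
  proof (rule ccontr)
    assume "W \<noteq> topspace K"
    then have Ane: "topspace K - W \<noteq> {}" using openin_subset[OF Wo] by blast
    define A where "A = topspace K - W"
    have Acl: "closedin K A" unfolding A_def using Wo by (simp add: closedin_diff)
    obtain U where U: "U \<noteq> {}" "openin (subtopology K A) U"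
      "finite_dimensional_space (subtopology K U)" "second_countable (subtopology K U)"
      using loc[of A] Ane unfolding A_def by auto
    obtain T where T: "openin K T" "U = T \<inter> A" using U(2) by (auto simp: openin_subtopology)
    obtain p where p: "p \<in> T" "p \<in> A" using U(1) T(2) by blast
    have reg: "regular_space K" using K compact_Hausdorff_imp_regular_space by blast
    obtain P V where PV: "openin K P" "closedin K V" "p \<in> P" "P \<subseteq> V" "V \<subseteq> T"
      using regular_space_shrink[OF reg T(1) p(1)] by blast
    \<comment> \<open>\<open>U\<close> need not be compact; \<open>X\<close> is a closed
      neighbourhood of \<open>p\<close> in \<open>A\<close> inside \<open>U\<close>, so it is
      compact and inherits finite dimension.\<close>
    define X where "X = V \<inter> A"
    have Xcl: "closedin K X" unfolding X_def using PV(2) Acl by (rule closedin_Int)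
    have XU: "X \<subseteq> U" using PV(5) T(2) by (auto simp: X_def)
    have eq: "subtopology K X = subtopology (subtopology K U) X"
      using XU by (simp add: subtopology_subtopology Int_absorb1)
    have topX: "topspace (subtopology K X) = X" using closedin_subset[OF Xcl] by auto
    have "closedin (subtopology K U) X" using Xcl XU by (rule closedin_subset_topspace)
    then have fd: "finite_dimensional_space (subtopology K X)"
      unfolding eq by (rule finite_dimensional_space_closed_subtopology[OF U(3)])
    have sc: "second_countable (subtopology K X)"
      unfolding eq using U(4) by (rule second_countable_subtopology)
    have cp: "compact_space (subtopology K X)"
      using closedin_compact_space[OF K(1) Xcl] by (rule compact_space_subtopology)
    obtain N and G :: "nat \<Rightarrow> 'a \<Rightarrow> real" where G: "\<forall>i<N. continuous_map (subtopology K X) euclideanreal (G i)"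
      "\<forall>x\<in>X. \<forall>y\<in>X. (\<forall>i<N. G i x = G i y) \<longrightarrow> x = y"
      using finite_separating_functions[OF cp Hausdorff_space_subtopology[OF K(2)] sc fd] unfolding topX
      by (elim exE conjE)
    have "normal_space K" using K compact_Hausdorff_or_regular_imp_normal_space by blast
    then have "\<exists>h. continuous_map K euclideanreal h \<and> (\<forall>x\<in>X. h x = G i x)" if "i < N" for i
      using Tietze_extension_realinterval[of K X UNIV "G i"] Xcl G(1) that by (metis UNIV_not_empty is_interval_univ subset_UNIV)
    then obtain h where h: "\<And>i. i < N \<Longrightarrow> continuous_map K euclideanreal (h i)"
      "\<And>i x. i < N \<Longrightarrow> x \<in> X \<Longrightarrow> h i x = G i x" by metis
    \<comment> \<open>The new functions are finitely many, so they preserve point-finiteness without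
      any cut-off. They only have to separate pairs outside \<open>W\<close>, and the part of
      \<open>P\<close> outside \<open>W\<close> lies in \<open>X\<close>.\<close>
    let ?F = "F \<union> h ` {..<N}"
    have WP: "openin K (W \<union> P)" using Wo PV(1) by (rule openin_Un)
    then have WPK: "W \<union> P \<subseteq> topspace K" by (rule openin_subset)
    have "separating_family K (W \<union> P) ?F"
      unfolding separating_family_def
    proof (intro conjI ballI impI)
      show "continuous_map K euclideanreal f" if "f \<in> ?F" for f using that Fc h(1) by blast
      fix x assume x: "x \<in> W \<union> P"
      have "{f \<in> ?F. f x \<noteq> 0} \<subseteq> {f \<in> F. f x \<noteq> 0} \<union> h ` {..<N}" by blast
      moreover have "finite {f \<in> F. f x \<noteq> 0}" using Ffin x WPK by blast
      ultimately show "finite {f \<in> ?F. f x \<noteq> 0}" by (meson finite_Un finite_imageI finite_lessThan finite_subset)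
      fix y assume y: "y \<in> W \<union> P" "x \<noteq> y"
      have xyK: "x \<in> topspace K" "y \<in> topspace K" using x y WPK by auto
      consider "x \<in> W" | "y \<in> W" | "x \<notin> W" "y \<notin> W" by blast
      then show "\<exists>f\<in>?F. f x \<noteq> f y"
      proof cases
        case 1
        then have "\<exists>f\<in>F. f x \<noteq> f y" using Fsep[rule_format, OF _ xyK(2) y(2)] by simp
        then show ?thesis by (elim bexE) (rule bexI, assumption, rule UnI1)
      next
        case 2
        then have "\<exists>f\<in>F. f y \<noteq> f x" using Fsep[rule_format, OF _ xyK(1) y(2)[symmetric]] by simp
        then show ?thesis by (elim bexE) (rule bexI, erule not_sym, rule UnI1)
      next
        case 3
        then have X: "x \<in> X" "y \<in> X" using x y(1) PV(4) xyK by (auto simp: X_def A_def)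
        then obtain i where i: "i < N" "G i x \<noteq> G i y" using G(2) y(2) by blast
        then have "h i x \<noteq> h i y" using h(2) X by simp
        moreover have "h i \<in> ?F" using i(1) by simp
        ultimately show ?thesis by (rule bexI)
      qed
    qed
    then have "W \<union> P \<in> \<O>" using WP unfolding \<O>_def by blast
    then have "p \<in> W" using PV(3) unfolding W_def by blast
    then show False using p(2) by (simp add: A_def)
  qed
  then show ?thesis using F omega_corson_iff_separating_family[OF K(1)] by blast
qed

section \<open>Local structure from a closure preserving cover\<close>

lemma closure_preserving_cover_imp_hereditarily_metacompact:
  assumes K: "compact_space K" "Hausdorff_space K"
    and cp: "closure_preserving_in K \<A>" and cov: "\<Union>\<A> = topspace K"
    and A: "\<And>A. A \<in> \<A> \<Longrightarrow> compactin K A \<and> metrizable_space (subtopology K A) \<and>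
                 finite_dimensional_space (subtopology K A)"
  shows "hereditarily_metacompact_space K"
    and "B \<subseteq> topspace K \<Longrightarrow> B \<noteq> {} \<Longrightarrow> \<exists>U. U \<noteq> {} \<and> openin (subtopology K B) U \<and>
              finite_dimensional_space (subtopology K U) \<and> second_countable (subtopology K U)"
proof -
  have Acl: "closedin K A" if "A \<in> \<A>" for A using A[OF that] K(2) compactin_imp_closedin by blast
  have clo: "closedin K (\<Union>\<B>)" if B: "\<B> \<subseteq> \<A>" for \<B>
  proof -
    have "K closure_of (\<Union>\<B>) = (\<Union>A\<in>\<B>. K closure_of A)" using cp B by (simp add: closure_preserving_in_def)
    also have "\<dots> = \<Union>\<B>" using B Acl closure_of_closedin by (auto, blast+)
    finally show ?thesis using closure_of_eq by blast
  qed
  \<comment> \<open>This is where metrizability of the members enters the cozero covers: relatively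
    open subsets of \<open>A\<close> are countable unions of closed sets.\<close>
  have sig: "\<exists>C::nat \<Rightarrow> 'a set. (\<forall>n. closedin K (C n)) \<and> A - G = (\<Union>n. C n)"
    if AA: "A \<in> \<A>" and G: "closedin K G" for A G
  proof -
    have "closedin (subtopology K A) (A \<inter> G)" using G by (rule closedin_subtopology_Int_closed)
    moreover have "topspace (subtopology K A) = A" using closedin_subset[OF Acl[OF AA]] by auto
    ultimately have "openin (subtopology K A) (A - A \<inter> G)" by (metis openin_diff openin_topspace)
    then have "fsigma_in (subtopology K A) (A - A \<inter> G)" using A[OF AA] open_imp_fsigma_in by blast
    then obtain C :: "nat \<Rightarrow> 'a set" where C: "\<forall>n. closedin (subtopology K A) (C n)" "\<Union>(range C) = A - A \<inter> G"
      unfolding fsigma_in_ascending by blast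
    have "\<forall>n. closedin K (C n)" using C(1) Acl[OF AA] closedin_trans_full by blast
    moreover have "A - G = (\<Union>n. C n)" using C(2) by blast
    ultimately show ?thesis by blast
  qed
  show "hereditarily_metacompact_space K"
  proof (rule hereditarily_metacompact_cozero[OF K(1)])
    fix G assume G: "closedin K G"
    show "\<exists>F. cozero_cover K G (topspace K) F"
    proof -
      obtain F where "cozero_cover K G (\<Union>\<A>) F"
        using cozero_cover_of_closed_family[of K \<A> \<A> G] K clo sig cov G by auto
      then show ?thesis unfolding cov by (rule exI)
    qed
  qed
  assume B: "B \<subseteq> topspace K" "B \<noteq> {}"
  have BC: "B \<subseteq> K closure_of B" using B(1) by (rule closure_of_subset)
  then have "\<exists>U A. openin K U \<and> A \<in> \<A> \<and> U \<inter> K closure_of B \<noteq> {} \<and> U \<inter> K closure_of B \<subseteq> A"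
    using B by (intro relatively_open_subset_of_member[OF K clo cov]) (auto simp: closure_of_subset_topspace)
  then obtain U A0 where U: "openin K U" "A0 \<in> \<A>" "U \<inter> K closure_of B \<noteq> {}" "U \<inter> K closure_of B \<subseteq> A0"
    by (elim exE conjE)
  have "U \<inter> B \<noteq> {}" using openin_Int_closure_of_eq_empty[OF U(1)] U(3) by blast
  have QA: "U \<inter> B \<subseteq> A0" using U(4) BC by blast
  let ?A = "subtopology K A0" and ?Q = "subtopology K (U \<inter> B)"
  have topA: "topspace ?A = A0" using closedin_subset[OF Acl[OF U(2)]] by auto
  have topQ: "topspace ?Q = U \<inter> B" using B by auto
  have eq: "?Q = subtopology ?A (U \<inter> B)" using QA by (simp add: subtopology_subtopology Int_absorb1)
  have cA: "compact_space ?A" using A[OF U(2)] compact_space_subtopology by blast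
  have scA: "second_countable ?A" using cA A[OF U(2)] compact_metrizable_imp_second_countable by blast
  obtain N and G :: "nat \<Rightarrow> 'a \<Rightarrow> real" where G: "\<forall>i<N. continuous_map ?A euclideanreal (G i)"
    "\<forall>x\<in>A0. \<forall>y\<in>A0. (\<forall>i<N. G i x = G i y) \<longrightarrow> x = y"
    using finite_separating_functions[OF cA Hausdorff_space_subtopology[OF K(2)] scA] A[OF U(2)] unfolding topA
    by blast
  \<comment> \<open>\<open>U \<inter> B\<close> need not be closed in \<open>A0\<close>. The
    coordinates of \<open>A0\<close> are restricted to it instead; their neighbourhood property,
    proved by compactness of \<open>A0\<close>, passes to every subspace.\<close>
  have "finite_dimensional_space ?Q"
  proof (rule finite_dimensional_space_coordinates[of "{..<N}" _ G])
    show "continuous_map ?Q euclideanreal (G i)" if "i \<in> {..<N}" for i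
      unfolding eq by (rule continuous_map_from_subtopology) (use G(1) that in simp)
    fix S x assume S: "openin ?Q S" "x \<in> S"
    obtain T where T: "openin ?A T" "S = T \<inter> (U \<inter> B)" using S(1) unfolding eq openin_subtopology[of ?A] by blast
    have "\<exists>e>0. \<forall>y\<in>topspace ?A. (\<forall>i\<in>{..<N}. \<bar>G i y - G i x\<bar> < e) \<longrightarrow> y \<in> T"
      by (rule compact_coordinates_neighbourhood[OF cA _ _ T(1)]) (use G S(2) T(2) topA in auto)
    then show "\<exists>e>0. \<forall>y\<in>topspace ?Q. (\<forall>i\<in>{..<N}. \<bar>G i y - G i x\<bar> < e) \<longrightarrow> y \<in> S"
      unfolding topA topQ using QA T(2) by (elim exE conjE) (rule exI, auto)
  qed simp
  moreover have "second_countable ?Q" unfolding eq using scA by (rule second_countable_subtopology)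
  moreover have "openin (subtopology K B) (U \<inter> B)" using U(1) by (rule openin_subtopology_Int)
  ultimately show "\<exists>U. U \<noteq> {} \<and> openin (subtopology K B) U \<and>
              finite_dimensional_space (subtopology K U) \<and> second_countable (subtopology K U)"
    using \<open>U \<inter> B \<noteq> {}\<close> by (intro exI[of _ "U \<inter> B"] conjI)
qed

theorem theorem4p6:
  fixes K :: "'a topology"
  assumes "compact_space K" and "Hausdorff_space K"
  shows
    "(omega_corson K \<longleftrightarrow>
       (\<exists>\<A>. closure_preserving_in K \<A> \<and> \<Union>\<A> = topspace K \<and>
         (\<forall>A\<in>\<A>. compactin K A \<and> metrizable_space (subtopology K A) \<and>
                 finite_dimensional_space (subtopology K A)))) \<and>
     (omega_corson K \<longleftrightarrow>
       hereditarily_metacompact_space K \<and>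
       (\<forall>A\<subseteq>topspace K. A \<noteq> {} \<longrightarrow>
         (\<exists>U. U \<noteq> {} \<and> openin (subtopology K A) U \<and>
              finite_dimensional_space (subtopology K U) \<and>
              second_countable (subtopology K U))))"
    (is "(?i \<longleftrightarrow> ?ii) \<and> (?i \<longleftrightarrow> ?iii)")
proof -
  have 1: "?ii" if "?i" using omega_corson_imp_closure_preserving_cover[OF assms that] .
  have 2: "?iii" if "?ii"
  proof -
    from that obtain \<A> where A: "closure_preserving_in K \<A>" "\<Union>\<A> = topspace K"
      "\<forall>A\<in>\<A>. compactin K A \<and> metrizable_space (subtopology K A) \<and> finite_dimensional_space (subtopology K A)"
      by (elim exE conjE)
    note * = closure_preserving_cover_imp_hereditarily_metacompact[OF assms A(1,2) bspec[OF A(3)]]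
    show ?thesis using *(1) *(2) by simp
  qed
  have 3: "?i" if "?iii"
    using that by (intro hereditarily_metacompact_imp_omega_corson[OF assms]) simp_all
  show ?thesis using 1 2 3 by argo
qed

end
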